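(* Assume: (1) $Z$ is independent of $\eta$, the $Z_t$ are i.i.d., and for each $\vartheta\in\Theta$, $t\in\mathbb Z$, $\varphi(Z_t,\vartheta)$ has a density $f(x,\vartheta)$; (2) $\eta$ is a Markov chain and there are $\kappa\ge 1$, $\phi_*>0$ such that $\Pr\{\eta_t=b\mid\eta_s=a\}\ge\phi_*$ for all $a,b\in\mathcal H$ and $s,t\in\mathbb Z$ with $|s-t|\ge\kappa$; (3) for each $z\in\mathcal Z$, $a,b\in\mathcal H$, $0<f(\varphi(z,\theta_a(\varepsilon)),\theta_b(\varepsilon))<\infty$ and this is continuous in $\varepsilon$. Then almost surely, as $n\to\infty$, for all $a\in\mathcal H$, $\Lambda_{\pm n,a}(\varepsilon)$ converge uniformly on every compact set of $\varepsilon$. The limits $$\mathsf L_a(\varepsilon)=\lim_{n\to\infty}\Lambda_{n,a}(\varepsilon),\qquad \bar{\mathsf L}_a(\varepsilon)=\lim_{n\to\infty}\Lambda_{-n,a}(\varepsilon)$$ are strictly positive and continuous, and there is a deterministic increasing function $r(\varepsilon_0)\in(0,1)$ of $\varepsilon_0>0$, such that almost surely, as $n\to\infty$, $$\sup_{|\varepsilon|\le\varepsilon_0}|\Lambda_{n,a}(\varepsilon)-\mathsf L_a(\varepsilon)|=o(r(\varepsilon_0)^n)\qquad\forall\,\varepsilon_0>0,$$ and likewise for $\Lambda_{-n,a}$ and $\bar{\mathsf L}_a(\varepsilon)$.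
   Context: Model: $\mathcal H$ is a finite set partitioned into nonempty subsets $\mathcal H_0$ and $\mathcal H_1$; $\eta=(\eta_t)_{t\in\mathbb Z}$ is an $\mathcal H$-valued process; $Z=(Z_t)_{t\in\mathbb Z}$ takes values in a Euclidean space $\mathcal Z$; $\Theta\subset\mathbb R^d$ is open; $\varphi(\cdot,\vartheta):\mathcal Z\to\mathcal X$, $\vartheta\in\Theta$, is a family of maps into a Euclidean space $\mathcal X$; $\theta_a:\mathbb R^p\to\Theta$, $a\in\mathcal H$, are functions; $\varepsilon\in\mathbb R^p$. Let $\sigma=(\sigma_t)$ be an independent copy of $\eta$, also independent of $Z$; $\mathsf E_\sigma$ is expectation with respect to $\sigma$ ($\eta$, $Z$ held fixed). Let $\psi_t(\varepsilon,c)=f(\varphi(Z_t,\theta_{\eta_t}(\varepsilon)),\theta_c(\varepsilon))$ for $c\in\mathcal H$. Fix an arbitrary $\imath\in\mathcal H$ and define, for $n\ge1$, $$\Lambda_{\pm n,a}(\varepsilon)=\frac{\mathsf E_\sigma[\prod_{s=1}^n\psi_{\pm s}(\varepsilon,\sigma_{\pm s})\mid\sigma_0=a]}{\mathsf E_\sigma[\prod_{s=1}^n\psi_{\pm s}(\varepsilon,\sigma_{\pm s})\mid\sigma_0=\imath]}.$$ *)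

theory Defs
  imports "HOL-Probability.Probability" "HOL-Library.Landau_Symbols"
begin

text \<open>\<^const>\<open>prob_space.indep_var\<close> requires both random variables to have the same value type. This is
  its characterization \<open>prob_space.indep_var_eq\<close> without that restriction.\<close>

definition indep_rv ::
  "'w measure \<Rightarrow> 'a measure \<Rightarrow> ('w \<Rightarrow> 'a) \<Rightarrow> 'b measure \<Rightarrow> ('w \<Rightarrow> 'b) \<Rightarrow> bool" where
  "indep_rv M S X T Y \<longleftrightarrow>
     X \<in> measurable M S \<and> Y \<in> measurable M T \<and>
     prob_space.indep_set M
       (sigma_sets (space M) {X -` A \<inter> space M |A. A \<in> sets S})
       (sigma_sets (space M) {Y -` A \<inter> space M |A. A \<in> sets T})"

text \<open>Discrete-state Markov chain indexed by the integers, not assumed time-homogeneous or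
  stationary. Conditioning on all finite stretches of the past determines conditioning on the
  whole past.\<close>

definition markov_chain :: "'w measure \<Rightarrow> (int \<Rightarrow> 'w \<Rightarrow> 'h) \<Rightarrow> bool" where
  "markov_chain M X \<longleftrightarrow>
     (\<forall>t. X t \<in> measurable M (count_space UNIV)) \<and>
     (\<forall>t (n::nat) (x :: int \<Rightarrow> 'h) b.
        measure M {\<omega> \<in> space M. \<forall>s\<in>{t - int n..t}. X s \<omega> = x s} > 0 \<longrightarrow>
        \<P>(\<omega> in M. X (t + 1) \<omega> = b \<bar> (\<forall>s\<in>{t - int n..t}. X s \<omega> = x s)) =
        \<P>(\<omega> in M. X (t + 1) \<omega> = b \<bar> X t \<omega> = x t))"

text \<open>Densities are \<open>ennreal\<close>-valued, as for \<^const>\<open>distributed\<close>. The conversion to \<open>real\<close>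
  loses nothing here, since the values below are assumed finite.\<close>

definition psi ::
  "('x \<Rightarrow> 'd \<Rightarrow> ennreal) \<Rightarrow> ('z \<Rightarrow> 'd \<Rightarrow> 'x) \<Rightarrow> ('h \<Rightarrow> 'e \<Rightarrow> 'd) \<Rightarrow>
   (int \<Rightarrow> 'w \<Rightarrow> 'z) \<Rightarrow> (int \<Rightarrow> 'w \<Rightarrow> 'h) \<Rightarrow> 'w \<Rightarrow> int \<Rightarrow> 'e \<Rightarrow> 'h \<Rightarrow> real" where
  "psi f \<phi> \<theta> Z \<eta> \<omega> t \<epsilon> c = enn2real (f (\<phi> (Z t \<omega>) (\<theta> (\<eta> t \<omega>) \<epsilon>)) (\<theta> c \<epsilon>))"

text \<open>The numerator of \<open>\<Lambda>\<close> at signed index \<open>k\<close>. The outcome \<open>\<omega>\<close> holds \<open>\<eta>\<close> and \<open>Z\<close> fixed; only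
  \<open>\<sigma>\<close> is integrated, over \<open>\<omega>'\<close>, under the conditional probability given \<open>\<sigma>\<^sub>0 = a\<close>. The factors run
  over the times \<open>1, \<dots>, k\<close> if \<open>k > 0\<close> and \<open>-1, \<dots>, k\<close> if \<open>k < 0\<close>.\<close>

definition cond_expect_sigma ::
  "'w measure \<Rightarrow> ('x \<Rightarrow> 'd \<Rightarrow> ennreal) \<Rightarrow> ('z \<Rightarrow> 'd \<Rightarrow> 'x) \<Rightarrow> ('h \<Rightarrow> 'e \<Rightarrow> 'd) \<Rightarrow>
   (int \<Rightarrow> 'w \<Rightarrow> 'z) \<Rightarrow> (int \<Rightarrow> 'w \<Rightarrow> 'h) \<Rightarrow> (int \<Rightarrow> 'w \<Rightarrow> 'h) \<Rightarrow>
   int \<Rightarrow> 'h \<Rightarrow> 'e \<Rightarrow> 'w \<Rightarrow> real" where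
  "cond_expect_sigma M f \<phi> \<theta> Z \<eta> \<sigma> k a \<epsilon> \<omega> =
     (LINT \<omega>' | uniform_measure M {\<omega>' \<in> space M. \<sigma> 0 \<omega>' = a}.
        (\<Prod>s = 1..nat \<bar>k\<bar>. psi f \<phi> \<theta> Z \<eta> \<omega> (sgn k * int s) \<epsilon> (\<sigma> (sgn k * int s) \<omega>')))"

definition Lambda ::
  "'w measure \<Rightarrow> ('x \<Rightarrow> 'd \<Rightarrow> ennreal) \<Rightarrow> ('z \<Rightarrow> 'd \<Rightarrow> 'x) \<Rightarrow> ('h \<Rightarrow> 'e \<Rightarrow> 'd) \<Rightarrow>
   (int \<Rightarrow> 'w \<Rightarrow> 'z) \<Rightarrow> (int \<Rightarrow> 'w \<Rightarrow> 'h) \<Rightarrow> (int \<Rightarrow> 'w \<Rightarrow> 'h) \<Rightarrow> 'h \<Rightarrow>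
   int \<Rightarrow> 'h \<Rightarrow> 'e \<Rightarrow> 'w \<Rightarrow> real" where
  "Lambda M f \<phi> \<theta> Z \<eta> \<sigma> i k a \<epsilon> \<omega> =
     cond_expect_sigma M f \<phi> \<theta> Z \<eta> \<sigma> k a \<epsilon> \<omega> / cond_expect_sigma M f \<phi> \<theta> Z \<eta> \<sigma> k i \<epsilon> \<omega>"

end

theory Submission imports Defs begin

text \<open>Write \<open>Y\<^sub>s = \<sigma>\<^bsub>\<plusminus>s\<^esub>\<close>. Since \<open>Y\<close> is a Markov chain on a finite set, the conditional expectation
of \<open>\<Prod> \<psi>\<^sub>s(Y\<^sub>s)\<close> given \<open>Y\<^sub>0 = a\<close> is the sum of row \<open>a\<close> of a product of nonnegative matrices
\<open>T\<^sub>s(a,b) = p\<^sub>s(a,b) \<psi>\<^bsub>s+1\<^esub>(b)\<close> (\<open>cond_expectation_weighted_path\<close>). Hence \<open>\<Lambda>\<close> compares two rows of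
such a product, and the theorem is a statement about the alignment of rows in inhomogeneous matrix
products.

Group the times into blocks of length \<open>\<kappa>\<close>. By the mixing assumption the product over block \<open>j\<close> has all
its entries between \<open>\<rho>\<^sub>j \<beta>\<^sub>j\<close> and \<open>\<beta>\<^sub>j\<close>, where \<open>\<rho>\<^sub>j\<close> is the mixing constant times a product of the
oscillation ratios \<open>min\<^sub>b \<psi>\<^sub>s(b) / max\<^sub>b \<psi>\<^sub>s(b)\<close>. If the entrywise ratios of rows \<open>a\<close> and \<open>i\<close> lie in an
interval, then multiplication by such a block places them in a subinterval shorter by the factor
\<open>1 - \<rho>\<^sub>j\<close> (\<open>kernel_contraction\<close>), and multiplication by any nonnegative matrix keeps them in the interval.
So \<open>\<Lambda>\<^sub>n \<ge> \<rho>\<^sub>0\<close> for \<open>n \<ge> \<kappa>\<close>, and over the times \<open>n \<ge> (J + 1) \<kappa>\<close> it oscillates by at most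
\<open>\<rho>\<^sub>0\<^sup>-\<^sup>1 \<Prod>\<^bsub>1 \<le> j \<le> J\<^esub> (1 - \<rho>\<^sub>j)\<close> (\<open>N_ratio_dist\<close>).

For \<open>\<epsilon>\<close> in a fixed ball the oscillation ratio at time \<open>s\<close> is bounded below by a positive measurable
function of \<open>Z\<^sub>s\<close> alone, because the ball is compact, the densities are continuous, and the minimum over
the finitely many values of \<open>\<eta>\<^sub>s\<close> may be taken. With this bound the factors \<open>1 - \<rho>\<^sub>j\<close> are i.i.d. with mean
\<open>q < 1\<close>, so the expected product over \<open>J\<close> blocks is \<open>q\<^sup>J\<close>. For \<open>q < t < 1\<close> the products divided by \<open>t\<^sup>J\<close> have
a convergent sum of expectations and therefore tend to \<open>0\<close> almost surely
(\<open>AE_iid_block_product_decay\<close>). This gives the rate \<open>t\<^bsup>1/\<kappa>\<^esup>\<close>, uniformly on the ball. Balls of integer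
radius suffice for the almost sure statement; \<open>strict_mono_rate_above\<close> interpolates their rates by one
increasing function.

Negative times need no separate argument: a Markov chain run backwards is again a Markov chain
(\<open>positive_markov_backward\<close>).\<close>

section \<open>Products of nonnegative matrices and contraction of row ratios\<close>

text \<open>The product of the matrices \<open>T m, \<dots>, T (m + k - 1)\<close>: time varies, so the starting index is a parameter.\<close>

primrec mprod :: "(nat \<Rightarrow> 'h \<Rightarrow> 'h \<Rightarrow> real) \<Rightarrow> nat \<Rightarrow> nat \<Rightarrow> 'h::finite \<Rightarrow> 'h \<Rightarrow> real" where
  "mprod T m 0 = (\<lambda>a b. of_bool (a = b))"
| "mprod T m (Suc k) = (\<lambda>a c. \<Sum>b\<in>UNIV. mprod T m k a b * T (m + k) b c)"

lemma mprod_add: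
  "mprod T m (k + l) a c = (\<Sum>b\<in>UNIV. mprod T m k a b * mprod T (m + k) l b c)"
proof (induction l arbitrary: c)
  case 0
  show ?case by simp
next
  case (Suc l)
  have "mprod T m (k + Suc l) a c =
    (\<Sum>d\<in>UNIV. \<Sum>b\<in>UNIV. mprod T m k a b * mprod T (m + k) l b d * T (m + k + l) d c)"
    by (simp add: Suc.IH sum_distrib_right add.assoc)
  also have "\<dots> = (\<Sum>b\<in>UNIV. \<Sum>d\<in>UNIV. mprod T m k a b * mprod T (m + k) l b d * T (m + k + l) d c)"
    by (rule sum.swap)
  finally show ?case by (simp add: sum_distrib_left mult.assoc)
qed

lemma mprod_nonneg:
  assumes "\<And>s a b. T s a b \<ge> 0"
  shows "mprod T m k a b \<ge> 0"
  by (induction k arbitrary: b) (auto intro!: sum_nonneg mult_nonneg_nonneg assms)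

text \<open>Stochastic matrices \<open>p s\<close> from time \<open>s\<close> to \<open>s + 1\<close> and the weight \<open>\<psi> s\<close> collected on arrival at
time \<open>s\<close>; this is why \<open>T s\<close> below carries \<open>\<psi> (Suc s)\<close> and \<open>\<psi> 0\<close> never occurs in a product.\<close>

locale weighted_kernel =
  fixes p :: "nat \<Rightarrow> 'h::finite \<Rightarrow> 'h \<Rightarrow> real" and \<psi> :: "nat \<Rightarrow> 'h \<Rightarrow> real"
  assumes p_nonneg: "p s a b \<ge> 0"
    and p_sum: "(\<Sum>b\<in>UNIV. p s a b) = 1"
    and \<psi>_pos: "\<psi> s b > 0"
begin

definition T :: "nat \<Rightarrow> 'h \<Rightarrow> 'h \<Rightarrow> real" where
  "T s a b = p s a b * \<psi> (Suc s) b"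

lemma T_nonneg: "T s a b \<ge> 0"
  by (simp add: T_def p_nonneg \<psi>_pos less_imp_le)

definition lo :: "nat \<Rightarrow> real" where "lo s = Min (range (\<psi> s))"
definition hi :: "nat \<Rightarrow> real" where "hi s = Max (range (\<psi> s))"

lemma lo_le: "lo s \<le> \<psi> s b" and le_hi: "\<psi> s b \<le> hi s" and lo_pos: "lo s > 0" and hi_pos: "hi s > 0"
proof -
  show "lo s \<le> \<psi> s b" and *: "\<psi> s b \<le> hi s" by (simp_all add: lo_def hi_def)
  show "lo s > 0" by (simp add: lo_def \<psi>_pos)
  show "hi s > 0" using * \<psi>_pos[of s b] by linarith
qed

text \<open>Replacing each weight by its extreme value over the states makes it a scalar, which factors out of
the matrix product.\<close>

lemma mprod_T_bounds:
  "(\<Prod>s=Suc m..m + k. lo s) * mprod p m k a b \<le> mprod T m k a b"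
  "mprod T m k a b \<le> (\<Prod>s=Suc m..m + k. hi s) * mprod p m k a b"
proof (induction k arbitrary: b)
  case 0
  { case 1 show ?case by simp }
  { case 2 show ?case by simp }
next
  case (Suc k)
  have *: "prod w {Suc m..m + Suc k} = prod w {Suc m..m + k} * w (Suc (m + k))" for w :: "nat \<Rightarrow> real"
    by (simp add: prod.nat_ivl_Suc')
  { case 1
    have "(\<Prod>s=Suc m..m + k. lo s) * mprod p m k a d * (p (m + k) d b * lo (Suc (m + k)))
        \<le> mprod T m k a d * T (m + k) d b" for d
      unfolding T_def[of "m + k" d b]
      by (intro mult_mono Suc.IH mult_left_mono lo_le p_nonneg mult_nonneg_nonneg mprod_nonneg prod_nonneg
           T_nonneg less_imp_le[OF lo_pos])
    then show ?case
      unfolding * by (auto simp: sum_distrib_left mult_ac intro!: sum_mono) }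
  { case 2
    have "mprod T m k a d * T (m + k) d b \<le>
        (\<Prod>s=Suc m..m + k. hi s) * mprod p m k a d * (p (m + k) d b * hi (Suc (m + k)))" for d
      unfolding T_def[of "m + k" d b]
      by (intro mult_mono Suc.IH mult_left_mono le_hi p_nonneg mult_nonneg_nonneg mprod_nonneg prod_nonneg
           T_nonneg less_imp_le[OF hi_pos] less_imp_le[OF \<psi>_pos])
    then show ?case
      unfolding * by (auto simp: sum_distrib_left mult_ac intro!: sum_mono) }
qed

lemma mprod_p_sum: "(\<Sum>b\<in>UNIV. mprod p m k a b) = 1"
proof (induction k)
  case 0
  show ?case by simp
next
  case (Suc k)
  have "(\<Sum>b\<in>UNIV. mprod p m (Suc k) a b) = (\<Sum>d\<in>UNIV. \<Sum>b\<in>UNIV. mprod p m k a d * p (m + k) d b)"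
    unfolding mprod.simps by (rule sum.swap)
  also have "\<dots> = 1" by (simp add: sum_distrib_left[symmetric] p_sum Suc.IH)
  finally show ?case .
qed

lemma mprod_p_le_1: "mprod p m k a b \<le> 1"
  using member_le_sum[of b UNIV "mprod p m k a"] mprod_nonneg[of p m k a, OF p_nonneg]
  by (simp add: mprod_p_sum)

text \<open>The numerator of \<open>\<Lambda>\<close>: see \<open>cond_expectation_weighted_path\<close>.\<close>

definition N :: "nat \<Rightarrow> 'h \<Rightarrow> real" where
  "N n a = (\<Sum>b\<in>UNIV. mprod T 0 n a b)"

lemma N_pos: "N n a > 0"
proof -
  have "0 < (\<Prod>s=Suc 0..0 + n. lo s)" by (intro prod_pos lo_pos)
  also have "\<dots> = (\<Sum>b\<in>UNIV. (\<Prod>s=Suc 0..0 + n. lo s) * mprod p 0 n a b)"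
    by (simp only: sum_distrib_left[symmetric] mprod_p_sum mult_1_right)
  also have "\<dots> \<le> N n a" unfolding N_def by (intro sum_mono mprod_T_bounds)
  finally show ?thesis .
qed

end

text \<open>Doeblin's argument in ratio form. The rows \<open>G - l G'\<close> and \<open>u G' - G\<close> are nonnegative, and a kernel
with comparable entries spreads the mass of each over all columns. With \<open>d\<close> the ratio of the total
masses of \<open>G\<close> and \<open>G'\<close>, every entry of \<open>G K\<close> therefore exceeds \<open>l\<close> times that of \<open>G' K\<close> by at least the
proportion \<open>\<rho> (d - l)\<close>, and falls short of \<open>u\<close> times it by at least \<open>\<rho> (u - d)\<close>. The two gains add up to
\<open>\<rho> (u - l)\<close>.\<close>

lemma kernel_contraction:
  fixes G G' :: "'h::finite \<Rightarrow> real"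
  assumes K: "\<And>b c. \<alpha> \<le> K b c" "\<And>b c. K b c \<le> \<beta>" and "0 < \<alpha>"
    and G': "\<And>b. 0 \<le> G' b" "0 < (\<Sum>b\<in>UNIV. G' b)"
    and bnd: "\<And>b. l * G' b \<le> G b" "\<And>b. G b \<le> u * G' b"
    and \<rho>: "0 \<le> \<rho>" "\<rho> * \<beta> \<le> \<alpha>"
  obtains l' u' where "l \<le> l'" "u' \<le> u" "l' \<le> u'" "u' - l' = (1 - \<rho>) * (u - l)"
    "\<And>c. l' * (\<Sum>b\<in>UNIV. G' b * K b c) \<le> (\<Sum>b\<in>UNIV. G b * K b c)"
    "\<And>c. (\<Sum>b\<in>UNIV. G b * K b c) \<le> u' * (\<Sum>b\<in>UNIV. G' b * K b c)"
proof -
  define s where "s = (\<Sum>b\<in>UNIV. G' b)"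
  define d where "d = (\<Sum>b\<in>UNIV. G b) / s"
  have s: "s > 0" using G' by (simp add: s_def)
  have ds: "d * s = (\<Sum>b\<in>UNIV. G b)" using s by (simp add: d_def)
  have ld: "l \<le> d" and du: "d \<le> u"
    using sum_mono[of UNIV "\<lambda>b. l * G' b" G] sum_mono[of UNIV G "\<lambda>b. u * G' b"] bnd s
    by (simp_all add: d_def le_divide_eq divide_le_eq sum_distrib_left[symmetric] s_def)
  have "\<rho> \<le> 1"
  proof -
    have "\<alpha> \<le> \<beta>" using order_trans[OF K] .
    then have "\<rho> * \<beta> \<le> 1 * \<beta>" using \<rho> by simp
    moreover have "\<beta> > 0" using \<open>\<alpha> \<le> \<beta>\<close> \<open>0 < \<alpha>\<close> by simp
    ultimately show ?thesis by (simp only: mult_le_cancel_right_pos)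
  qed
  have up: "\<rho> * (\<Sum>b\<in>UNIV. G' b * K b c) \<le> \<alpha> * s" for c
  proof -
    have "(\<Sum>b\<in>UNIV. G' b * K b c) \<le> (\<Sum>b\<in>UNIV. G' b * \<beta>)"
      by (intro sum_mono mult_left_mono K G')
    also have "\<dots> = \<beta> * s" by (simp add: sum_distrib_left s_def mult.commute)
    finally have "\<rho> * (\<Sum>b\<in>UNIV. G' b * K b c) \<le> \<rho> * (\<beta> * s)" using \<rho> by (intro mult_left_mono)
    also have "\<dots> = (\<rho> * \<beta>) * s" by simp
    also have "\<dots> \<le> \<alpha> * s" using \<rho> s by (intro mult_right_mono) auto
    finally show ?thesis .
  qed
  show thesis
  proof (rule that[of "l + \<rho> * (d - l)" "u - \<rho> * (u - d)"])
    show "l \<le> l + \<rho> * (d - l)" "u - \<rho> * (u - d) \<le> u" using ld du \<rho> by auto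
    show eq: "u - \<rho> * (u - d) - (l + \<rho> * (d - l)) = (1 - \<rho>) * (u - l)" by (simp add: algebra_simps)
    have "0 \<le> (1 - \<rho>) * (u - l)" using \<open>\<rho> \<le> 1\<close> ld du by simp
    then show "l + \<rho> * (d - l) \<le> u - \<rho> * (u - d)" using eq by linarith
  next
    fix c
    let ?S = "\<Sum>b\<in>UNIV. G' b * K b c" and ?R = "\<Sum>b\<in>UNIV. G b * K b c"
    have "?R - l * ?S = (\<Sum>b\<in>UNIV. (G b - l * G' b) * K b c)"
      by (simp only: sum_distrib_left left_diff_distrib sum_subtractf mult.assoc)
    also have "\<dots> \<ge> (\<Sum>b\<in>UNIV. (G b - l * G' b) * \<alpha>)"
      using bnd by (intro sum_mono mult_left_mono K) auto
    also have "(\<Sum>b\<in>UNIV. (G b - l * G' b) * \<alpha>) = (d - l) * (\<alpha> * s)"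
      by (simp only: sum_distrib_right[symmetric] sum_subtractf sum_distrib_left[symmetric] ds[symmetric] s_def[symmetric])
        (simp add: algebra_simps)
    also have "(d - l) * (\<alpha> * s) \<ge> (d - l) * (\<rho> * ?S)"
      using ld by (intro mult_left_mono up) auto
    finally show "(l + \<rho> * (d - l)) * ?S \<le> ?R" by (simp add: algebra_simps)
    have "u * ?S - ?R = (\<Sum>b\<in>UNIV. (u * G' b - G b) * K b c)"
      by (simp only: sum_distrib_left left_diff_distrib sum_subtractf mult.assoc)
    also have "\<dots> \<ge> (\<Sum>b\<in>UNIV. (u * G' b - G b) * \<alpha>)"
      using bnd by (intro sum_mono mult_left_mono K) auto
    also have "(\<Sum>b\<in>UNIV. (u * G' b - G b) * \<alpha>) = (u - d) * (\<alpha> * s)"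
      by (simp only: sum_distrib_right[symmetric] sum_subtractf sum_distrib_left[symmetric] ds[symmetric] s_def[symmetric])
        (simp add: algebra_simps)
    also have "(u - d) * (\<alpha> * s) \<ge> (u - d) * (\<rho> * ?S)"
      using du by (intro mult_left_mono up) auto
    finally show "?R \<le> (u - \<rho> * (u - d)) * ?S" by (simp add: algebra_simps)
  qed
qed

text \<open>The number \<open>w s\<close> is any lower bound for the ratio of the smallest to the largest weight at time \<open>s\<close>.
Leaving it free allows one choice for a whole ball of parameters.\<close>

locale mixing_kernel = weighted_kernel p \<psi>
  for p :: "nat \<Rightarrow> 'h::finite \<Rightarrow> 'h \<Rightarrow> real" and \<psi> :: "nat \<Rightarrow> 'h \<Rightarrow> real" +
  fixes \<kappa> :: nat and \<delta> :: real and w :: "nat \<Rightarrow> real"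
  assumes \<delta>_pos: "0 < \<delta>"
    and mix: "\<delta> \<le> mprod p s \<kappa> a b"
    and w_pos: "0 < w s" and w_le_1: "w s \<le> 1"
    and w_osc: "w s * \<psi> s c \<le> \<psi> s b"
begin

definition \<rho> :: "nat \<Rightarrow> real" where
  "\<rho> j = \<delta> * (\<Prod>s=Suc (j * \<kappa>)..j * \<kappa> + \<kappa>. w s)"

lemma \<rho>_pos: "0 < \<rho> j"
  by (simp add: \<rho>_def \<delta>_pos prod_pos w_pos)

lemma \<rho>_le_1: "\<rho> j \<le> 1"
proof -
  have "\<delta> \<le> 1" using order_trans[OF mix mprod_p_le_1] .
  moreover have "(\<Prod>s=Suc (j * \<kappa>)..j * \<kappa> + \<kappa>. w s) \<le> 1"
    by (intro prod_le_1) (auto simp: w_pos less_imp_le w_le_1)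
  ultimately show ?thesis
    unfolding \<rho>_def using \<delta>_pos by (intro mult_le_one prod_nonneg) (auto simp: w_pos less_imp_le)
qed

definition block_max :: "nat \<Rightarrow> real" where
  "block_max j = (\<Prod>s=Suc (j * \<kappa>)..j * \<kappa> + \<kappa>. hi s)"

lemma block_max_pos: "0 < block_max j"
  by (simp add: block_max_def prod_pos hi_pos)

lemma w_hi_le_lo: "w s * hi s \<le> lo s"
proof -
  have "hi s \<in> range (\<psi> s)" "lo s \<in> range (\<psi> s)"
    unfolding hi_def lo_def by (intro Max_in Min_in; simp)+
  then show ?thesis using w_osc by auto
qed

lemma block_bounds:
  "\<rho> j * block_max j \<le> mprod T (j * \<kappa>) \<kappa> a b" "mprod T (j * \<kappa>) \<kappa> a b \<le> block_max j"
proof -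
  let ?I = "{Suc (j * \<kappa>)..j * \<kappa> + \<kappa>}"
  have "prod w ?I * block_max j = (\<Prod>s\<in>?I. w s * hi s)"
    by (simp add: block_max_def prod.distrib)
  also have "\<dots> \<le> prod lo ?I"
    by (intro prod_mono) (auto simp: w_hi_le_lo w_pos hi_pos less_imp_le)
  finally have "prod w ?I * block_max j * \<delta> \<le> prod lo ?I * mprod p (j * \<kappa>) \<kappa> a b"
    using \<delta>_pos by (intro mult_mono mix prod_nonneg) (auto simp: lo_pos less_imp_le)
  also note mprod_T_bounds(1)
  finally show "\<rho> j * block_max j \<le> mprod T (j * \<kappa>) \<kappa> a b"
    by (simp add: \<rho>_def mult_ac)
  have "mprod T (j * \<kappa>) \<kappa> a b \<le> block_max j * mprod p (j * \<kappa>) \<kappa> a b"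
    using mprod_T_bounds(2) by (simp add: block_max_def)
  also have "\<dots> \<le> block_max j * 1"
    using block_max_pos[of j] by (intro mult_left_mono mprod_p_le_1) auto
  finally show "mprod T (j * \<kappa>) \<kappa> a b \<le> block_max j" by simp
qed

text \<open>Block \<open>0\<close> makes all entries comparable and so gives the initial interval \<open>[\<rho> 0, 1 / \<rho> 0]\<close>; each later
block contracts it. The lower end never drops below \<open>\<rho> 0\<close>, which makes the limits positive.\<close>

lemma row_ratio_interval:
  "\<exists>l u. \<rho> 0 \<le> l \<and> l \<le> u \<and> u - l \<le> (1 / \<rho> 0) * (\<Prod>j=1..J. 1 - \<rho> j) \<and>
     (\<forall>b. l * mprod T 0 (Suc J * \<kappa>) i b \<le> mprod T 0 (Suc J * \<kappa>) a b \<and>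
          mprod T 0 (Suc J * \<kappa>) a b \<le> u * mprod T 0 (Suc J * \<kappa>) i b)"
proof (induction J)
  case 0
  have "1 \<le> 1 / \<rho> 0" using \<rho>_pos[of 0] \<rho>_le_1[of 0] by (simp add: field_simps)
  then have r: "\<rho> 0 \<le> 1 / \<rho> 0" using \<rho>_le_1[of 0] by linarith
  have *: "\<rho> 0 * mprod T 0 \<kappa> c b \<le> mprod T 0 \<kappa> d b" for b c d
  proof -
    have "\<rho> 0 * mprod T 0 \<kappa> c b \<le> \<rho> 0 * block_max 0"
      using block_bounds(2)[of 0 c b] \<rho>_pos[of 0] by (intro mult_left_mono) auto
    also have "\<dots> \<le> mprod T 0 \<kappa> d b" using block_bounds(1)[of 0 d b] by simp
    finally show ?thesis .
  qed
  have "mprod T 0 \<kappa> d b \<le> 1 / \<rho> 0 * mprod T 0 \<kappa> c b" for b c d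
    using * \<rho>_pos[of 0] by (simp add: pos_le_divide_eq mult.commute)
  with * r \<rho>_pos[of 0] have "\<rho> 0 \<le> \<rho> 0 \<and> \<rho> 0 \<le> 1 / \<rho> 0 \<and> 1 / \<rho> 0 - \<rho> 0 \<le> (1 / \<rho> 0) * (\<Prod>j=1..0. 1 - \<rho> j) \<and>
     (\<forall>b. \<rho> 0 * mprod T 0 (Suc 0 * \<kappa>) i b \<le> mprod T 0 (Suc 0 * \<kappa>) a b \<and>
          mprod T 0 (Suc 0 * \<kappa>) a b \<le> (1 / \<rho> 0) * mprod T 0 (Suc 0 * \<kappa>) i b)"
    by simp
  then show ?case by blast
next
  case (Suc J)
  let ?G = "mprod T 0 (Suc J * \<kappa>)"
  from Suc.IH obtain l u where lu: "\<rho> 0 \<le> l" "l \<le> u" "u - l \<le> (1 / \<rho> 0) * (\<Prod>j=1..J. 1 - \<rho> j)"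
    and b: "\<And>b. l * ?G i b \<le> ?G a b" "\<And>b. ?G a b \<le> u * ?G i b" by blast
  let ?K = "mprod T (Suc J * \<kappa>) \<kappa>"
  have G_pos: "0 < (\<Sum>b\<in>UNIV. ?G i b)" using N_pos unfolding N_def .
  obtain l' u' where l'u': "l \<le> l'" "u' \<le> u" "l' \<le> u'" "u' - l' = (1 - \<rho> (Suc J)) * (u - l)"
    "\<And>c. l' * (\<Sum>b\<in>UNIV. ?G i b * ?K b c) \<le> (\<Sum>b\<in>UNIV. ?G a b * ?K b c)"
    "\<And>c. (\<Sum>b\<in>UNIV. ?G a b * ?K b c) \<le> u' * (\<Sum>b\<in>UNIV. ?G i b * ?K b c)"
    by (rule kernel_contraction[where K = ?K, OF block_bounds(1)[of "Suc J"] block_bounds(2)[of "Suc J"] _ mprod_nonneg[of T, OF T_nonneg] G_pos b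
          less_imp_le[OF \<rho>_pos] order_refl]) (use \<rho>_pos block_max_pos in \<open>auto intro: mult_pos_pos\<close>)
  have eq: "mprod T 0 (Suc (Suc J) * \<kappa>) x c = (\<Sum>b\<in>UNIV. ?G x b * ?K b c)" for x c
  proof -
    have "Suc (Suc J) * \<kappa> = Suc J * \<kappa> + \<kappa>" by simp
    then show ?thesis by (simp only: mprod_add add_0)
  qed
  have "u' - l' \<le> (1 - \<rho> (Suc J)) * ((1 / \<rho> 0) * (\<Prod>j=1..J. 1 - \<rho> j))"
    unfolding l'u'(4) using \<rho>_le_1[of "Suc J"] lu by (intro mult_left_mono) auto
  also have "\<dots> = (1 / \<rho> 0) * (\<Prod>j=1..Suc J. 1 - \<rho> j)"
    by (simp add: prod.nat_ivl_Suc')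
  finally show ?case unfolding eq using order_trans[OF lu(1) l'u'(1)] l'u'(3,5,6) by blast
qed

text \<open>The entrywise bounds on the rows survive multiplication by any further nonnegative matrices,
whether or not they complete a block, and summation over the columns.\<close>

lemma N_ratio_interval:
  "\<exists>l u. \<rho> 0 \<le> l \<and> l \<le> u \<and> u - l \<le> (1 / \<rho> 0) * (\<Prod>j=1..J. 1 - \<rho> j) \<and>
     (\<forall>n \<ge> Suc J * \<kappa>. l \<le> N n a / N n i \<and> N n a / N n i \<le> u)"
proof -
  let ?G = "mprod T 0 (Suc J * \<kappa>)"
  from row_ratio_interval[of J i a] obtain l u where lu: "\<rho> 0 \<le> l" "l \<le> u"
    "u - l \<le> (1 / \<rho> 0) * (\<Prod>j=1..J. 1 - \<rho> j)"
    and b: "\<And>b. l * ?G i b \<le> ?G a b" "\<And>b. ?G a b \<le> u * ?G i b" by blast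
  have "l \<le> N n a / N n i \<and> N n a / N n i \<le> u" if n: "n \<ge> Suc J * \<kappa>" for n
  proof -
    define m where "m = Suc J * \<kappa>"
    define k where "k = n - m"
    have n': "n = m + k" using n by (simp add: k_def m_def)
    have N: "N n x = (\<Sum>c\<in>UNIV. \<Sum>b\<in>UNIV. ?G x b * mprod T m k b c)" for x
      unfolding N_def n' mprod_add by (simp add: m_def)
    have nn: "0 \<le> mprod T m k b c" for b c by (rule mprod_nonneg[OF T_nonneg])
    have "l * N n i = (\<Sum>c\<in>UNIV. \<Sum>b\<in>UNIV. (l * ?G i b) * mprod T m k b c)"
      by (simp add: N sum_distrib_left mult.assoc)
    also have "\<dots> \<le> N n a" unfolding N by (intro sum_mono mult_right_mono b nn)
    finally have 1: "l * N n i \<le> N n a" .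
    have "N n a \<le> (\<Sum>c\<in>UNIV. \<Sum>b\<in>UNIV. (u * ?G i b) * mprod T m k b c)"
      unfolding N by (intro sum_mono mult_right_mono b nn)
    also have "\<dots> = u * N n i"
      by (simp add: N sum_distrib_left mult.assoc)
    finally show ?thesis using 1 N_pos[of n i] by (simp add: le_divide_eq divide_le_eq)
  qed
  then show ?thesis using lu by blast
qed

lemma N_ratio_ge: "n \<ge> \<kappa> \<Longrightarrow> \<rho> 0 \<le> N n a / N n i"
  using N_ratio_interval[of 0 a i] by fastforce

lemma N_ratio_dist:
  assumes "n \<ge> Suc J * \<kappa>" "m \<ge> Suc J * \<kappa>"
  shows "\<bar>N n a / N n i - N m a / N m i\<bar> \<le> (1 / \<rho> 0) * (\<Prod>j=1..J. 1 - \<rho> j)"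
proof -
  obtain l u where *: "u - l \<le> (1 / \<rho> 0) * (\<Prod>j=1..J. 1 - \<rho> j)"
    "\<And>n. n \<ge> Suc J * \<kappa> \<Longrightarrow> l \<le> N n a / N n i" "\<And>n. n \<ge> Suc J * \<kappa> \<Longrightarrow> N n a / N n i \<le> u"
    using N_ratio_interval[of J a i] by blast
  show ?thesis using * (1) *(2,3)[OF assms(1)] *(2,3)[OF assms(2)] by linarith
qed

end

section \<open>From oscillation bounds to limits and rates\<close>

lemma locally_uniform_limit_from_bound:
  fixes \<Lambda> :: "nat \<Rightarrow> 'e::euclidean_space \<Rightarrow> real" and D :: "nat \<Rightarrow> nat \<Rightarrow> real" and c :: "nat \<Rightarrow> real"
  assumes cont: "\<And>n. continuous_on UNIV (\<Lambda> n)"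
    and c: "\<And>k. c k > 0"
    and ge': "\<forall>k. \<forall>\<epsilon>\<in>cball 0 (real k). \<forall>n\<ge>\<kappa>. c k \<le> \<Lambda> n \<epsilon>"
    and D: "\<And>k. D k \<longlonglongrightarrow> 0"
    and dist': "\<forall>k J. \<forall>\<epsilon>\<in>cball 0 (real k). \<forall>n\<ge>Suc J * \<kappa>. \<forall>m\<ge>Suc J * \<kappa>.
       \<bar>\<Lambda> n \<epsilon> - \<Lambda> m \<epsilon>\<bar> \<le> D k J"
  defines "L \<equiv> \<lambda>\<epsilon>. lim (\<lambda>n. \<Lambda> n \<epsilon>)"
  shows "\<And>K. compact K \<Longrightarrow> uniform_limit K \<Lambda> L sequentially"
    and "\<And>\<epsilon>. L \<epsilon> > 0"
    and "continuous_on UNIV L"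
    and "\<And>k J n \<epsilon>. \<epsilon> \<in> cball 0 (real k) \<Longrightarrow> n \<ge> Suc J * \<kappa> \<Longrightarrow> \<bar>\<Lambda> n \<epsilon> - L \<epsilon>\<bar> \<le> D k J"
proof -
  have ge: "c k \<le> \<Lambda> n \<epsilon>" if "\<epsilon> \<in> cball 0 (real k)" "n \<ge> \<kappa>" for k n \<epsilon>
    using ge' that by blast
  have dist: "\<bar>\<Lambda> n \<epsilon> - \<Lambda> m \<epsilon>\<bar> \<le> D k J"
    if "\<epsilon> \<in> cball 0 (real k)" "n \<ge> Suc J * \<kappa>" "m \<ge> Suc J * \<kappa>" for k J n m \<epsilon>
    using dist' that by blast
  have in_ball: "\<exists>k. \<epsilon> \<in> cball 0 (real k)" for \<epsilon> :: 'e
    using real_arch_simple[of "norm \<epsilon>"] by auto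
  have small: "\<exists>J. D k J < e" if "e > 0" for k e
  proof -
    have "eventually (\<lambda>J. D k J < e) sequentially" using order_tendstoD(2)[OF D that] .
    then show ?thesis by (auto simp: eventually_sequentially)
  qed
  have lim: "(\<lambda>n. \<Lambda> n \<epsilon>) \<longlonglongrightarrow> L \<epsilon>" for \<epsilon>
  proof -
    obtain k where k: "\<epsilon> \<in> cball 0 (real k)" using in_ball by blast
    have "Cauchy (\<lambda>n. \<Lambda> n \<epsilon>)"
    proof (rule CauchyI)
      fix e :: real assume "e > 0"
      then obtain J where "D k J < e" using small by blast
      then show "\<exists>M. \<forall>m\<ge>M. \<forall>n\<ge>M. norm (\<Lambda> m \<epsilon> - \<Lambda> n \<epsilon>) < e"
        using dist[OF k, of J] by (intro exI[of _ "Suc J * \<kappa>"]) (auto intro: le_less_trans)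
    qed
    then show ?thesis unfolding L_def by (simp add: Cauchy_convergent convergent_LIMSEQ_iff[symmetric])
  qed
  show bnd: "\<bar>\<Lambda> n \<epsilon> - L \<epsilon>\<bar> \<le> D k J" if "\<epsilon> \<in> cball 0 (real k)" "n \<ge> Suc J * \<kappa>" for k J n \<epsilon>
  proof (rule Lim_bounded)
    show "(\<lambda>m. \<bar>\<Lambda> n \<epsilon> - \<Lambda> m \<epsilon>\<bar>) \<longlonglongrightarrow> \<bar>\<Lambda> n \<epsilon> - L \<epsilon>\<bar>"
      by (intro tendsto_intros lim)
    show "\<forall>m\<ge>Suc J * \<kappa>. \<bar>\<Lambda> n \<epsilon> - \<Lambda> m \<epsilon>\<bar> \<le> D k J" using dist that by blast
  qed
  show "L \<epsilon> > 0" for \<epsilon>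
  proof -
    obtain k where k: "\<epsilon> \<in> cball 0 (real k)" using in_ball by blast
    have "c k \<le> L \<epsilon>" using Lim_bounded2[OF lim, of \<kappa> "c k"] ge[OF k] by blast
    then show ?thesis using c[of k] by linarith
  qed
  show unif: "uniform_limit K \<Lambda> L sequentially" if "compact K" for K
  proof -
    obtain B where "\<And>\<epsilon>. \<epsilon> \<in> K \<Longrightarrow> norm \<epsilon> \<le> B"
      using compact_imp_bounded[OF \<open>compact K\<close>] unfolding bounded_iff by blast
    moreover obtain k where "B \<le> real k" using real_arch_simple by blast
    ultimately have K: "\<epsilon> \<in> cball 0 (real k)" if "\<epsilon> \<in> K" for \<epsilon> using that by fastforce
    show ?thesis
    proof (rule uniform_limitI)
      fix e :: real assume "e > 0"
      then obtain J where J: "D k J < e" using small by blast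
      show "\<forall>\<^sub>F n in sequentially. \<forall>\<epsilon>\<in>K. dist (\<Lambda> n \<epsilon>) (L \<epsilon>) < e"
        using eventually_ge_at_top[of "Suc J * \<kappa>"]
        by eventually_elim (auto simp: dist_real_def intro: le_less_trans[OF bnd[OF K] J])
    qed
  qed
  have "continuous_on (cball 0 (real k)) L" for k
    by (rule uniform_limit_theorem[OF _ unif[OF compact_cball]])
      (auto intro!: always_eventually continuous_on_subset[OF cont])
  then have "continuous_on (ball 0 (real k)) L" for k
    by (meson continuous_on_subset ball_subset_cball)
  then have "continuous_on (\<Union>k. ball 0 (real k)) L"
    by (intro continuous_on_open_UN) auto
  moreover have "(\<Union>k. ball 0 (real k)) = (UNIV :: 'e set)"
    using reals_Archimedean2 by auto
  ultimately show "continuous_on UNIV L" by simp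
qed

text \<open>A bound per block of length \<open>\<kappa>\<close> is converted into a rate per unit of time.\<close>

lemma block_rate_smallo:
  fixes D a :: "nat \<Rightarrow> real"
  assumes D: "(\<lambda>J. D J / t ^ J) \<longlonglongrightarrow> 0" and t: "0 < t" and "\<kappa> > 0"
    and r: "0 < r" "r < 1" "t \<le> r ^ \<kappa>"
    and a: "\<And>n J. n \<ge> Suc J * \<kappa> \<Longrightarrow> \<bar>a n\<bar> \<le> D J"
  shows "a \<in> o(\<lambda>n. r ^ n)"
proof (rule smalloI_tendsto)
  define J where "J n = n div \<kappa> - 1" for n
  have J_lim: "filterlim J at_top sequentially"
    unfolding filterlim_at_top
  proof
    fix Z
    show "\<forall>\<^sub>F n in sequentially. Z \<le> J n"
      using eventually_ge_at_top[of "Suc Z * \<kappa>"]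
    proof eventually_elim
      case (elim n)
      then have "Suc Z \<le> n div \<kappa>" using \<open>\<kappa> > 0\<close> by (simp add: less_eq_div_iff_mult_less_eq)
      then show ?case by (simp add: J_def)
    qed
  qed
  have "(\<lambda>n. D (J n) / t ^ J n) \<longlonglongrightarrow> 0"
    using filterlim_compose[OF D J_lim] .
  then have "(\<lambda>n. (1 / r ^ (2 * \<kappa>)) * (D (J n) / t ^ J n)) \<longlonglongrightarrow> (1 / r ^ (2 * \<kappa>)) * 0"
    by (intro tendsto_mult tendsto_const)
  then have lim: "(\<lambda>n. (1 / r ^ (2 * \<kappa>)) * (D (J n) / t ^ J n)) \<longlonglongrightarrow> 0" by simp
  show "(\<lambda>n. a n / r ^ n) \<longlonglongrightarrow> 0"
  proof (rule tendsto_rabs_zero_cancel, rule tendsto_sandwich[OF _ _ tendsto_const lim])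
    show "\<forall>\<^sub>F n in sequentially. 0 \<le> \<bar>a n / r ^ n\<bar>" by simp
    show "\<forall>\<^sub>F n in sequentially. \<bar>a n / r ^ n\<bar> \<le> (1 / r ^ (2 * \<kappa>)) * (D (J n) / t ^ J n)"
      using eventually_ge_at_top[of \<kappa>]
    proof eventually_elim
      case (elim n)
      then have "1 \<le> n div \<kappa>" using \<open>\<kappa> > 0\<close> by (simp add: less_eq_div_iff_mult_less_eq)
      then have SJ: "Suc (J n) = n div \<kappa>" by (simp add: J_def)
      then have "Suc (J n) * \<kappa> \<le> n" by simp
      then have aD: "\<bar>a n\<bar> \<le> D (J n)" using a by blast
      then have D0: "0 \<le> D (J n)" by linarith
      have "n < Suc (n div \<kappa>) * \<kappa>"
        using \<open>\<kappa> > 0\<close> dividend_less_div_times[of \<kappa> n] by simp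
      then have n: "n \<le> 2 * \<kappa> + \<kappa> * J n" unfolding SJ[symmetric] by (simp add: algebra_simps)
      \<comment> \<open>At most \<open>2 \<kappa>\<close> of the first \<open>n\<close> times lie outside the \<open>J n\<close> blocks; they cost the constant \<open>r ^ (2 * \<kappa>)\<close>.\<close>
      have "t ^ J n * r ^ (2 * \<kappa>) \<le> (r ^ \<kappa>) ^ J n * r ^ (2 * \<kappa>)"
        using t r by (intro mult_right_mono power_mono) auto
      also have "\<dots> = r ^ (2 * \<kappa> + \<kappa> * J n)" by (simp add: power_add power_mult)
      also have "\<dots> \<le> r ^ n" using r n by (intro power_decreasing) auto
      finally have le: "t ^ J n * r ^ (2 * \<kappa>) \<le> r ^ n" .
      have "\<bar>a n / r ^ n\<bar> = \<bar>a n\<bar> / r ^ n" using r by simp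
      also have "\<dots> \<le> D (J n) / (t ^ J n * r ^ (2 * \<kappa>))"
        using aD D0 le t r by (intro frac_le) auto
      finally show ?case by (simp add: mult.commute)
    qed
  qed
qed (use r in simp)

section \<open>Conditional expectations along a Markov chain\<close>

text \<open>The Markov property is stated as a product. Unlike the usual conditional form it is an equation about
all paths, including those of probability \<open>0\<close>, and so can be summed over paths.\<close>

locale positive_markov = prob_space M for M :: "'w measure" +
  fixes Y :: "nat \<Rightarrow> 'w \<Rightarrow> 'h::finite"
  assumes Y_meas [measurable]: "Y n \<in> measurable M (count_space UNIV)"
    and marginal_pos: "0 < prob {\<omega> \<in> space M. Y n \<omega> = a}"
    and markov: "prob {\<omega> \<in> space M. (\<forall>s\<le>n. Y s \<omega> = x s) \<and> Y (Suc n) \<omega> = c} =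
      prob {\<omega> \<in> space M. \<forall>s\<le>n. Y s \<omega> = x s} * \<P>(\<omega> in M. Y (Suc n) \<omega> = c \<bar> Y n \<omega> = x n)"
begin

definition p :: "nat \<Rightarrow> 'h \<Rightarrow> 'h \<Rightarrow> real" where
  "p n a b = \<P>(\<omega> in M. Y (Suc n) \<omega> = b \<bar> Y n \<omega> = a)"

lemma p_nonneg: "0 \<le> p n a b"
  by (simp add: p_def cond_prob_def)

lemma p_sum: "(\<Sum>b\<in>UNIV. p n a b) = 1"
proof -
  have "(\<Sum>b\<in>UNIV. prob {\<omega> \<in> space M. Y (Suc n) \<omega> = b \<and> Y n \<omega> = a}) =
      prob (\<Union>b\<in>UNIV. {\<omega> \<in> space M. Y (Suc n) \<omega> = b \<and> Y n \<omega> = a})"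
    by (intro finite_measure_finite_Union[symmetric]) (auto simp: disjoint_family_on_def)
  also have "(\<Union>b\<in>UNIV. {\<omega> \<in> space M. Y (Suc n) \<omega> = b \<and> Y n \<omega> = a}) = {\<omega> \<in> space M. Y n \<omega> = a}"
    by auto
  finally show ?thesis
    using marginal_pos[of n a] by (simp add: p_def cond_prob_def sum_divide_distrib[symmetric])
qed

text \<open>There are only finitely many paths up to time \<open>n\<close>, so an expectation of a function of the path is a
finite sum; this carries the Markov property from paths to expectations in the next lemma.\<close>

lemma integral_finite_path:
  fixes H :: "(nat \<Rightarrow> 'h) \<Rightarrow> real"
  assumes [measurable]: "A \<in> sets M"
  shows "(LINT \<omega>|M. H (restrict (\<lambda>s. Y s \<omega>) {..n}) * indicator A \<omega>) =
    (\<Sum>x\<in>{..n} \<rightarrow>\<^sub>E UNIV. H x * prob {\<omega> \<in> A. \<forall>s\<le>n. Y s \<omega> = x s})"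
proof -
  let ?P = "{..n} \<rightarrow>\<^sub>E (UNIV :: 'h set)"
  let ?E = "\<lambda>x. {\<omega> \<in> A. \<forall>s\<le>n. Y s \<omega> = x s}"
  have fin: "finite ?P" by (intro finite_PiE) auto
  have E [measurable]: "?E x \<in> sets M" for x
  proof -
    have "?E x = A \<inter> {\<omega> \<in> space M. \<forall>s\<in>{..n}. Y s \<omega> = x s}"
      using sets.sets_into_space[OF assms] by auto
    also have "\<dots> \<in> sets M" by measurable
    finally show ?thesis .
  qed
  have eq: "H (restrict (\<lambda>s. Y s \<omega>) {..n}) * indicator A \<omega> = (\<Sum>x\<in>?P. H x * indicator (?E x) \<omega>)" for \<omega>
  proof -
    let ?y = "restrict (\<lambda>s. Y s \<omega>) {..n}"
    have "(\<Sum>x\<in>?P. H x * indicator (?E x) \<omega>) = (\<Sum>x\<in>?P. if x = ?y then H x * indicator A \<omega> else 0)"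
    proof (intro sum.cong refl)
      fix x assume "x \<in> ?P"
      then have "x = ?y \<longleftrightarrow> (\<forall>s\<le>n. Y s \<omega> = x s)"
        by (auto simp: PiE_def extensional_def restrict_def fun_eq_iff)
      then show "H x * indicator (?E x) \<omega> = (if x = ?y then H x * indicator A \<omega> else 0)"
        by (auto simp: indicator_def)
    qed
    also have "\<dots> = H ?y * indicator A \<omega>"
      using fin by (simp add: sum.delta')
    finally show ?thesis by simp
  qed
  have "(LINT \<omega>|M. H (restrict (\<lambda>s. Y s \<omega>) {..n}) * indicator A \<omega>) =
      (LINT \<omega>|M. (\<Sum>x\<in>?P. H x * indicator (?E x) \<omega>))"
    by (simp only: eq)
  also have "\<dots> = (\<Sum>x\<in>?P. LINT \<omega>|M. H x * indicator (?E x) \<omega>)"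
    by (intro Bochner_Integration.integral_sum integrable_mult_right integrable_real_indicator E)
      (simp add: less_top[symmetric])
  also have "\<dots> = (\<Sum>x\<in>?P. H x * prob (?E x))"
    by (intro sum.cong refl) (simp add: E sets.Int_space_eq2)
  finally show ?thesis .
qed

lemma integral_markov_step:
  fixes H :: "(nat \<Rightarrow> 'h) \<Rightarrow> real"
  shows "(LINT \<omega>|M. H (restrict (\<lambda>s. Y s \<omega>) {..n}) * indicator {\<omega> \<in> space M. Y n \<omega> = b \<and> Y (Suc n) \<omega> = c} \<omega>) =
    p n b c * (LINT \<omega>|M. H (restrict (\<lambda>s. Y s \<omega>) {..n}) * indicator {\<omega> \<in> space M. Y n \<omega> = b} \<omega>)"
proof -
  let ?A = "{\<omega> \<in> space M. Y n \<omega> = b \<and> Y (Suc n) \<omega> = c}" and ?B = "{\<omega> \<in> space M. Y n \<omega> = b}"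
  have "prob {\<omega> \<in> ?A. \<forall>s\<le>n. Y s \<omega> = x s} = p n b c * prob {\<omega> \<in> ?B. \<forall>s\<le>n. Y s \<omega> = x s}" for x
  proof (cases "x n = b")
    case True
    then have A: "{\<omega> \<in> ?A. \<forall>s\<le>n. Y s \<omega> = x s} = {\<omega> \<in> space M. (\<forall>s\<le>n. Y s \<omega> = x s) \<and> Y (Suc n) \<omega> = c}"
      and B: "{\<omega> \<in> ?B. \<forall>s\<le>n. Y s \<omega> = x s} = {\<omega> \<in> space M. \<forall>s\<le>n. Y s \<omega> = x s}" by auto
    show ?thesis unfolding A B markov by (simp add: p_def True mult.commute)
  next
    case False
    then have A: "{\<omega> \<in> ?A. \<forall>s\<le>n. Y s \<omega> = x s} = {}" and B: "{\<omega> \<in> ?B. \<forall>s\<le>n. Y s \<omega> = x s} = {}" by auto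
    show ?thesis unfolding A B by simp
  qed
  then show ?thesis by (subst (1 2) integral_finite_path) (simp_all add: sum_distrib_left mult_ac)
qed

lemma integrable_weighted_path:
  assumes [measurable]: "A \<in> sets M"
  shows "integrable M (\<lambda>\<omega>. (\<Prod>s=Suc m..m + k. \<psi> s (Y s \<omega>)) * indicator A \<omega> :: real)"
proof (rule integrable_const_bound)
  let ?B = "\<Prod>s=Suc m..m + k. Max (range (\<lambda>c. \<bar>\<psi> s c\<bar>))"
  show "AE \<omega> in M. norm ((\<Prod>s=Suc m..m + k. \<psi> s (Y s \<omega>)) * indicator A \<omega>) \<le> ?B"
  proof (intro always_eventually allI)
    fix \<omega>
    have "\<bar>\<Prod>s=Suc m..m + k. \<psi> s (Y s \<omega>)\<bar> \<le> ?B"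
      unfolding abs_prod by (intro prod_mono) auto
    then show "norm ((\<Prod>s=Suc m..m + k. \<psi> s (Y s \<omega>)) * indicator A \<omega>) \<le> ?B"
      by (auto simp: indicator_def intro: order_trans[OF abs_ge_zero])
  qed
qed measurable

text \<open>The case \<open>\<psi> = 1\<close> is the Chapman--Kolmogorov equation, the case \<open>m = 0\<close> identifies the conditional
expectations in \<open>\<Lambda>\<close>.\<close>

lemma integral_weighted_path:
  "(LINT \<omega>|M. (\<Prod>s=Suc m..m + k. \<psi> s (Y s \<omega>)) * indicator {\<omega> \<in> space M. Y m \<omega> = a \<and> Y (m + k) \<omega> = b} \<omega>) =
    prob {\<omega> \<in> space M. Y m \<omega> = a} * mprod (\<lambda>s a b. p s a b * \<psi> (Suc s) b) m k a b"
proof (induction k arbitrary: b)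
  case 0
  show ?case by (cases "a = b") (auto simp: Int_def conj_commute intro!: arg_cong[where f = prob])
next
  case (Suc k)
  let ?W = "\<lambda>\<omega>. \<Prod>s=Suc m..m + k. \<psi> s (Y s \<omega>)"
  let ?T = "\<lambda>s a b. p s a b * \<psi> (Suc s) b"
  let ?A = "\<lambda>d. {\<omega> \<in> space M. Y m \<omega> = a \<and> Y (m + k) \<omega> = d \<and> Y (Suc (m + k)) \<omega> = b}"
  \<comment> \<open>The factor \<open>of_bool\<close> moves the condition at time \<open>m\<close> into the path functional, which \<open>integral_markov_step\<close> leaves arbitrary.\<close>
  define H where "H y = (\<Prod>s=Suc m..m + k. \<psi> s (y s)) * of_bool (y m = a)" for y :: "nat \<Rightarrow> 'h"
  have HY: "H (restrict (\<lambda>s. Y s \<omega>) {..m + k}) = ?W \<omega> * of_bool (Y m \<omega> = a)" for \<omega>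
    unfolding H_def by (intro arg_cong2[where f = "(*)"] prod.cong) auto
  have int: "integrable M (\<lambda>\<omega>. \<psi> (Suc (m + k)) b * (?W \<omega> * indicator (?A d) \<omega>))" for d
    by (intro integrable_mult_right integrable_weighted_path) measurable
  have "(LINT \<omega>|M. (\<Prod>s=Suc m..m + Suc k. \<psi> s (Y s \<omega>)) * indicator {\<omega> \<in> space M. Y m \<omega> = a \<and> Y (m + Suc k) \<omega> = b} \<omega>)
    = (LINT \<omega>|M. (\<Sum>d\<in>UNIV. \<psi> (Suc (m + k)) b * (?W \<omega> * indicator (?A d) \<omega>)))"
  proof (intro Bochner_Integration.integral_cong refl)
    fix \<omega> assume "\<omega> \<in> space M"
    then have "(\<Sum>d\<in>UNIV. \<psi> (Suc (m + k)) b * (?W \<omega> * indicator (?A d) \<omega>)) =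
       (\<Sum>d\<in>UNIV. if d = Y (m + k) \<omega> then \<psi> (Suc (m + k)) b * ?W \<omega> * of_bool (Y m \<omega> = a \<and> Y (Suc (m + k)) \<omega> = b) else 0)"
      by (intro sum.cong) (auto simp: indicator_def)
    then show "(\<Prod>s=Suc m..m + Suc k. \<psi> s (Y s \<omega>)) * indicator {\<omega> \<in> space M. Y m \<omega> = a \<and> Y (m + Suc k) \<omega> = b} \<omega> =
       (\<Sum>d\<in>UNIV. \<psi> (Suc (m + k)) b * (?W \<omega> * indicator (?A d) \<omega>))"
      using \<open>\<omega> \<in> space M\<close> by (auto simp: prod.nat_ivl_Suc' indicator_def)
  qed
  also have "\<dots> = (\<Sum>d\<in>UNIV. \<psi> (Suc (m + k)) b * (LINT \<omega>|M. ?W \<omega> * indicator (?A d) \<omega>))"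
    by (simp only: Bochner_Integration.integral_sum[OF int] integral_mult_right_zero)
  also have "\<dots> = (\<Sum>d\<in>UNIV. \<psi> (Suc (m + k)) b * (p (m + k) d b *
      (prob {\<omega> \<in> space M. Y m \<omega> = a} * mprod ?T m k a d)))"
  proof (intro sum.cong refl arg_cong2[where f = "(*)"])
    fix d
    have "(LINT \<omega>|M. ?W \<omega> * indicator (?A d) \<omega>) =
      (LINT \<omega>|M. H (restrict (\<lambda>s. Y s \<omega>) {..m + k}) * indicator {\<omega> \<in> space M. Y (m + k) \<omega> = d \<and> Y (Suc (m + k)) \<omega> = b} \<omega>)"
      unfolding HY by (intro Bochner_Integration.integral_cong) (auto simp: indicator_def)
    also have "\<dots> = p (m + k) d b * (LINT \<omega>|M. H (restrict (\<lambda>s. Y s \<omega>) {..m + k}) * indicator {\<omega> \<in> space M. Y (m + k) \<omega> = d} \<omega>)"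
      by (rule integral_markov_step)
    also have "(LINT \<omega>|M. H (restrict (\<lambda>s. Y s \<omega>) {..m + k}) * indicator {\<omega> \<in> space M. Y (m + k) \<omega> = d} \<omega>) =
       (LINT \<omega>|M. ?W \<omega> * indicator {\<omega> \<in> space M. Y m \<omega> = a \<and> Y (m + k) \<omega> = d} \<omega>)"
      unfolding HY by (intro Bochner_Integration.integral_cong) (auto simp: indicator_def)
    also note Suc.IH
    finally show "(LINT \<omega>|M. ?W \<omega> * indicator (?A d) \<omega>) =
      p (m + k) d b * (prob {\<omega> \<in> space M. Y m \<omega> = a} * mprod ?T m k a d)" .
  qed
  finally show ?case by (simp add: sum_distrib_left mult_ac)
qed

lemma mprod_p_eq_cond_prob:
  "mprod p m k a b = \<P>(\<omega> in M. Y (m + k) \<omega> = b \<bar> Y m \<omega> = a)"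
proof -
  have "prob {\<omega> \<in> space M. Y (m + k) \<omega> = b \<and> Y m \<omega> = a} =
     prob {\<omega> \<in> space M. Y m \<omega> = a} * mprod p m k a b"
    using integral_weighted_path[where \<psi> = "\<lambda>_ _. 1" and m = m and k = k and a = a and b = b]
    by (simp add: Int_def conj_ac cong: conj_cong)
  then show ?thesis using marginal_pos[of m a] by (simp add: cond_prob_def)
qed

lemma cond_expectation_weighted_path:
  "(LINT \<omega>|uniform_measure M {\<omega> \<in> space M. Y 0 \<omega> = a}. (\<Prod>s=1..n. \<psi> s (Y s \<omega>))) =
    (\<Sum>b\<in>UNIV. mprod (\<lambda>s a b. p s a b * \<psi> (Suc s) b) 0 n a b)"
proof -
  let ?A = "{\<omega> \<in> space M. Y 0 \<omega> = a}"
  let ?W = "\<lambda>\<omega>. \<Prod>s=Suc 0..0 + n. \<psi> s (Y s \<omega>)"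
  let ?B = "\<lambda>b. {\<omega> \<in> space M. Y 0 \<omega> = a \<and> Y (0 + n) \<omega> = b}"
  have pos: "0 < prob ?A" by (rule marginal_pos)
  have int: "integrable M (\<lambda>\<omega>. 1 / prob ?A * (?W \<omega> * indicator (?B b) \<omega>))" for b
    by (intro integrable_mult_right integrable_weighted_path) measurable
  have dens: "uniform_measure M ?A = density M (\<lambda>\<omega>. ennreal (indicator ?A \<omega> / prob ?A))"
    unfolding uniform_measure_def
    by (intro density_cong) (auto simp: emeasure_eq_measure indicator_def pos divide_ennreal intro!: AE_I2
        simp flip: ennreal_1)
  have "(LINT \<omega>|uniform_measure M ?A. ?W \<omega>) = (LINT \<omega>|M. indicator ?A \<omega> / prob ?A * ?W \<omega>)"
    unfolding dens by (subst integral_density) (auto intro!: AE_I2)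
  also have "\<dots> = (LINT \<omega>|M. (\<Sum>b\<in>UNIV. 1 / prob ?A * (?W \<omega> * indicator (?B b) \<omega>)))"
  proof (intro Bochner_Integration.integral_cong refl)
    fix \<omega> assume "\<omega> \<in> space M"
    then have "(\<Sum>b\<in>UNIV. 1 / prob ?A * (?W \<omega> * indicator (?B b) \<omega>)) =
      (\<Sum>b\<in>UNIV. if b = Y n \<omega> then 1 / prob ?A * ?W \<omega> * of_bool (Y 0 \<omega> = a) else 0)"
      by (intro sum.cong) (auto simp: indicator_def)
    then show "indicator ?A \<omega> / prob ?A * ?W \<omega> = (\<Sum>b\<in>UNIV. 1 / prob ?A * (?W \<omega> * indicator (?B b) \<omega>))"
      using \<open>\<omega> \<in> space M\<close> by (auto simp: indicator_def)
  qed
  also have "\<dots> = (\<Sum>b\<in>UNIV. 1 / prob ?A * (LINT \<omega>|M. ?W \<omega> * indicator (?B b) \<omega>))"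
    by (simp only: Bochner_Integration.integral_sum[OF int] integral_mult_right_zero)
  also have "\<dots> = (\<Sum>b\<in>UNIV. mprod (\<lambda>s a b. p s a b * \<psi> (Suc s) b) 0 n a b)"
    unfolding integral_weighted_path using pos by (intro sum.cong refl) simp
  finally show ?thesis by simp
qed

end

section \<open>Almost sure decay of products over independent blocks\<close>

text \<open>By continuity the infimum over \<open>K\<close> is the infimum over a countable dense subset, hence measurable; by
compactness it is attained, hence positive.\<close>

lemma measurable_positive_lower_bound:
  fixes h :: "'z \<Rightarrow> 'j::finite \<Rightarrow> 'e::euclidean_space \<Rightarrow> real"
  assumes meas [measurable]: "\<And>j \<epsilon>. (\<lambda>z. h z j \<epsilon>) \<in> borel_measurable N"
    and cont: "\<And>z j. continuous_on UNIV (h z j)"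
    and pos: "\<And>z j \<epsilon>. 0 < h z j \<epsilon>"
    and K: "compact K" "K \<noteq> {}"
  shows "\<exists>v \<in> borel_measurable N. (\<forall>z. 0 < v z) \<and> (\<forall>z j. \<forall>\<epsilon>\<in>K. v z \<le> h z j \<epsilon>)"
proof -
  obtain D where D: "countable D" "D \<subseteq> K" "K \<subseteq> closure D"
    using separable by blast
  have "D \<noteq> {}" using D K by auto
  define v where "v z = (INF x\<in>UNIV \<times> D. h z (fst x) (snd x))" for z
  have "\<exists>c>0. \<forall>j. \<forall>\<epsilon>\<in>K. c \<le> h z j \<epsilon>" for z
  proof -
    have "\<forall>j. \<exists>x\<in>K. \<forall>\<epsilon>\<in>K. h z j x \<le> h z j \<epsilon>"
      using continuous_attains_inf[OF K continuous_on_subset[OF cont]] by blast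
    then obtain x where x: "\<And>j \<epsilon>. \<epsilon> \<in> K \<Longrightarrow> h z j (x j) \<le> h z j \<epsilon>" by metis
    have "0 < Min (range (\<lambda>j. h z j (x j)))" by (simp add: pos)
    moreover have "Min (range (\<lambda>j. h z j (x j))) \<le> h z j \<epsilon>" if "\<epsilon> \<in> K" for j \<epsilon>
      by (rule order_trans[OF _ x[OF that]]) simp
    ultimately show ?thesis by blast
  qed
  then obtain c where c: "\<And>z. 0 < c z" "\<And>z j \<epsilon>. \<epsilon> \<in> K \<Longrightarrow> c z \<le> h z j \<epsilon>" by metis
  show ?thesis
  proof (intro bexI[of _ v] conjI allI ballI)
    show "v \<in> borel_measurable N"
      unfolding v_def by (intro borel_measurable_cINF_real) (auto simp: D)
    show "0 < v z" for z
      using c(1)[of z] by (rule less_le_trans) (use D c(2)[of _ z] \<open>D \<noteq> {}\<close> in \<open>auto simp: v_def intro!: cINF_greatest\<close>)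
  next
    fix z j \<epsilon> assume "\<epsilon> \<in> K"
    have bdd: "bdd_below ((\<lambda>x. h z (fst x) (snd x)) ` (UNIV \<times> D))"
      using c(2)[of _ z] D by (intro bdd_belowI[of _ "c z"]) auto
    have "v z \<le> h z j \<epsilon>'" if "\<epsilon>' \<in> D" for \<epsilon>'
      unfolding v_def using cINF_lower[OF bdd, of "(j, \<epsilon>')"] that by simp
    moreover have "\<epsilon> \<in> closure D" using \<open>\<epsilon> \<in> K\<close> D by auto
    ultimately show "v z \<le> h z j \<epsilon>"
      using continuous_ge_on_closure[of D "h z j" \<epsilon> "v z"] continuous_on_subset[OF cont] by blast
  qed
qed

context prob_space
begin

text \<open>Turns independence over the integers into independence along the two half-lines.\<close>

lemma indep_vars_reindex_inj:
  assumes ind: "indep_vars (\<lambda>_. N) X UNIV" and e: "inj e"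
  shows "indep_vars (\<lambda>_. N) (\<lambda>s. X (e s)) UNIV"
proof -
  have "indep_vars (\<lambda>s. PiM {e s} (\<lambda>_. N)) (\<lambda>s \<omega>. restrict (\<lambda>i. X i \<omega>) {e s}) UNIV"
    using e by (intro indep_vars_restrict[OF ind]) (auto simp: disjoint_family_on_def inj_def)
  then have "indep_vars (\<lambda>_. N) (\<lambda>s \<omega>. (\<lambda>x. x (e s)) (restrict (\<lambda>i. X i \<omega>) {e s})) UNIV"
    by (rule indep_vars_compose2) simp
  then show ?thesis by simp
qed

text \<open>The factors of the product depend on disjoint blocks of the i.i.d. sequence, so the expectation
of the product is \<open>q ^ J\<close> with \<open>q < 1\<close>. Dividing by \<open>t ^ J\<close> for some \<open>t\<close> between \<open>q\<close> and \<open>1\<close> leaves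
summable expectations, so the quotients have an almost surely finite sum.\<close>

lemma AE_iid_block_product_decay:
  fixes \<zeta> :: "nat \<Rightarrow> 'a \<Rightarrow> 'z" and v :: "'z \<Rightarrow> real"
  assumes ind: "indep_vars (\<lambda>_. N) \<zeta> UNIV"
    and ident: "\<And>s. distr M N (\<zeta> s) = distr M N (\<zeta> 0)"
    and v [measurable]: "v \<in> borel_measurable N"
    and v_bounds: "\<And>z. 0 < v z" "\<And>z. v z \<le> 1"
    and \<delta>: "0 < \<delta>" "\<delta> \<le> 1"
  shows "\<exists>t. 0 < t \<and> t < 1 \<and> (AE \<omega> in M.
    (\<lambda>J. (\<Prod>j=1..J. 1 - \<delta> * (\<Prod>s=Suc (j * \<kappa>)..j * \<kappa> + \<kappa>. v (\<zeta> s \<omega>))) / t ^ J) \<longlonglongrightarrow> 0)"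
proof -
  let ?B = "\<lambda>j. {Suc (j * \<kappa>)..j * \<kappa> + \<kappa>}"
  define X where "X j \<omega> = 1 - \<delta> * (\<Prod>s\<in>?B j. v (\<zeta> s \<omega>))" for j \<omega>
  define m where "m = expectation (\<lambda>\<omega>. v (\<zeta> 0 \<omega>))"
  define q where "q = 1 - \<delta> * m ^ \<kappa>"
  have \<zeta> [measurable]: "\<zeta> s \<in> measurable M N" for s
    using ind by (auto simp: indep_vars_def)
  have X_meas [measurable]: "X j \<in> borel_measurable M" for j
    unfolding X_def by measurable
  have int_v: "integrable M (\<lambda>\<omega>. v (\<zeta> s \<omega>))" for s
    by (rule integrable_const_bound[of _ 1]) (auto simp: v_bounds less_imp_le)
  have prod_v: "0 \<le> (\<Prod>s\<in>B. v (\<zeta> s \<omega>))" "(\<Prod>s\<in>B. v (\<zeta> s \<omega>)) \<le> 1" for B \<omega>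
    by (auto intro!: prod_nonneg prod_le_1 simp: v_bounds less_imp_le)
  have X01: "0 \<le> X j \<omega>" "X j \<omega> \<le> 1" for j \<omega>
    using prod_v[of \<omega> "?B j"] \<delta> by (auto simp: X_def intro: mult_le_one)
  have int_X: "integrable M (X j)" for j
    by (rule integrable_const_bound[of _ 1]) (auto simp: X01)
  have m: "expectation (\<lambda>\<omega>. v (\<zeta> s \<omega>)) = m" for s
  proof -
    have "expectation (\<lambda>\<omega>. v (\<zeta> s \<omega>)) = integral\<^sup>L (distr M N (\<zeta> s)) v"
      by (simp add: integral_distr)
    also have "\<dots> = m" unfolding ident[of s] m_def by (simp add: integral_distr)
    finally show ?thesis .
  qed
  have m_pos: "0 < m"
  proof -
    have "m \<noteq> 0"
    proof
      assume "m = 0"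
      then have "AE \<omega> in M. v (\<zeta> 0 \<omega>) = 0"
        unfolding m_def using int_v[of 0] v_bounds
        by (subst (asm) integral_nonneg_eq_0_iff_AE) (auto simp: less_imp_le)
      then have "AE \<omega> in M. False" using v_bounds(1) by (auto simp: less_le)
      then show False by simp
    qed
    moreover have "0 \<le> m" unfolding m_def by (intro Bochner_Integration.integral_nonneg) (simp add: v_bounds less_imp_le)
    ultimately show ?thesis by simp
  qed
  have EX: "expectation (X j) = q" for j
  proof -
    have i: "indep_vars (\<lambda>_. borel) (\<lambda>s \<omega>. v (\<zeta> s \<omega>)) (?B j)"
      by (rule indep_vars_compose2[OF indep_vars_subset[OF ind subset_UNIV]]) simp
    have "integrable M (\<lambda>\<omega>. \<Prod>s\<in>?B j. v (\<zeta> s \<omega>))"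
      by (rule indep_vars_integrable[OF _ i]) (simp_all add: int_v)
    moreover have "expectation (\<lambda>\<omega>. \<Prod>s\<in>?B j. v (\<zeta> s \<omega>)) = (\<Prod>s\<in>?B j. expectation (\<lambda>\<omega>. v (\<zeta> s \<omega>)))"
      by (rule indep_vars_lebesgue_integral[OF _ i]) (simp_all add: int_v)
    ultimately show ?thesis by (simp add: X_def[abs_def] q_def m prob_space)
  qed
  have q: "0 \<le> q" "q < 1"
  proof -
    show "0 \<le> q" unfolding EX[of 0, symmetric] by (intro Bochner_Integration.integral_nonneg) (simp add: X01)
    show "q < 1" unfolding q_def using \<delta> m_pos by simp
  qed
  have disj: "disjoint_family_on ?B S" for S
    unfolding disjoint_family_on_def
  proof (intro ballI impI)
    fix j k :: nat assume "j \<noteq> k"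
    have "?B j \<inter> ?B k = {}" if "j < k" for j k :: nat
    proof -
      have "Suc j * \<kappa> \<le> k * \<kappa>" using that by (intro mult_right_mono) auto
      then show ?thesis by auto
    qed
    then show "?B j \<inter> ?B k = {}" using \<open>j \<noteq> k\<close> by (metis inf_commute linorder_neqE_nat)
  qed
  have "indep_vars (\<lambda>j. PiM (?B j) (\<lambda>_. N)) (\<lambda>j \<omega>. restrict (\<lambda>s. \<zeta> s \<omega>) (?B j)) UNIV"
    by (intro indep_vars_restrict[OF ind] disj) auto
  then have "indep_vars (\<lambda>_. borel)
      (\<lambda>j \<omega>. (\<lambda>x. 1 - \<delta> * (\<Prod>s\<in>?B j. v (x s))) (restrict (\<lambda>s. \<zeta> s \<omega>) (?B j))) UNIV"
    by (rule indep_vars_compose2) measurable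
  moreover have "(\<lambda>x. 1 - \<delta> * (\<Prod>s\<in>?B j. v (x s))) (restrict (\<lambda>s. \<zeta> s \<omega>) (?B j)) = X j \<omega>" for j \<omega>
    by (simp add: X_def)
  ultimately have indX: "indep_vars (\<lambda>_. borel) X UNIV" by simp
  have iX: "indep_vars (\<lambda>_. borel) X {1..J}" for J :: nat
    by (rule indep_vars_subset[OF indX subset_UNIV])
  have int_W: "integrable M (\<lambda>\<omega>. \<Prod>j=1..J. X j \<omega>)" for J :: nat
    by (rule indep_vars_integrable[OF _ iX]) (simp_all add: int_X)
  have EW: "expectation (\<lambda>\<omega>. \<Prod>j=1..J. X j \<omega>) = q ^ J" for J :: nat
    by (subst indep_vars_lebesgue_integral[OF _ iX]) (simp_all add: int_X EX)
  \<comment> \<open>Any number strictly between \<open>q\<close> and \<open>1\<close> would do.\<close>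
  define t where "t = (1 + q) / 2"
  have t: "0 < t" "t < 1" "q < t" using q by (auto simp: t_def)
  define F where "F J \<omega> = (\<Prod>j=1..J. X j \<omega>) / t ^ J" for J \<omega>
  have F_nn: "0 \<le> F J \<omega>" for J \<omega> unfolding F_def using t by (intro divide_nonneg_nonneg prod_nonneg X01) auto
  have [measurable]: "F J \<in> borel_measurable M" for J unfolding F_def by measurable
  have int_F: "integrable M (F J)" for J
    unfolding F_def[abs_def] by (intro integrable_divide int_W)
  have EF: "(\<integral>\<^sup>+\<omega>. ennreal (F J \<omega>) \<partial>M) = ennreal ((q / t) ^ J)" for J
  proof -
    have "expectation (F J) = (q / t) ^ J"
      unfolding F_def[abs_def] using EW by (simp add: power_divide)
    then show ?thesis using nn_integral_eq_integral[OF int_F] F_nn by simp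
  qed
  have "(\<integral>\<^sup>+\<omega>. (\<Sum>J. ennreal (F J \<omega>)) \<partial>M) = (\<Sum>J. ennreal ((q / t) ^ J))"
    by (subst nn_integral_suminf) (simp_all add: EF)
  also have "\<dots> = ennreal (\<Sum>J. (q / t) ^ J)"
    using q t by (intro suminf_ennreal2) (auto intro!: summable_geometric)
  finally have fin: "(\<integral>\<^sup>+\<omega>. (\<Sum>J. ennreal (F J \<omega>)) \<partial>M) \<noteq> \<infinity>" by simp
  have "AE \<omega> in M. (\<Sum>J. ennreal (F J \<omega>)) \<noteq> \<infinity>"
    by (rule nn_integral_PInf_AE[OF _ fin]) measurable
  then have "AE \<omega> in M. (\<lambda>J. F J \<omega>) \<longlonglongrightarrow> 0"
  proof eventually_elim
    case (elim \<omega>)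
    then have "summable (\<lambda>J. F J \<omega>)"
      by (intro summable_suminf_not_top) (auto simp: F_nn)
    then show ?case by (rule summable_LIMSEQ_zero)
  qed
  then show ?thesis using t unfolding F_def X_def by blast
qed

end

section \<open>Limits of likelihood ratios on a half-line of times\<close>

context positive_markov
begin

definition weighted_cond_exp :: "('w \<Rightarrow> nat \<Rightarrow> 'h \<Rightarrow> real) \<Rightarrow> nat \<Rightarrow> 'h \<Rightarrow> 'w \<Rightarrow> real" where
  "weighted_cond_exp \<psi> n a \<omega> =
    (LINT \<omega>'|uniform_measure M {\<omega>' \<in> space M. Y 0 \<omega>' = a}. (\<Prod>s=1..n. \<psi> \<omega> s (Y s \<omega>')))"

text \<open>One time direction of the theorem. The rate is given for balls of integer radius \<open>k\<close>, so that a single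
null set serves all radii; it is then passed on to the radii \<open>\<epsilon>0 \<le> k\<close> and to all larger rates. The
process \<open>E\<close> is arbitrary because the lower bound \<open>v\<close> holds for all of its possible values.\<close>

lemma likelihood_ratio_limit:
  fixes g :: "'z \<Rightarrow> 'h \<Rightarrow> 'h \<Rightarrow> 'e::euclidean_space \<Rightarrow> real"
    and i :: 'h and \<zeta> :: "nat \<Rightarrow> 'w \<Rightarrow> 'z" and E :: "nat \<Rightarrow> 'w \<Rightarrow> 'h"
  assumes mix: "0 < \<delta>" "\<And>m a b. \<delta> \<le> \<P>(\<omega> in M. Y (m + \<kappa>) \<omega> = b \<bar> Y m \<omega> = a)"
    and "0 < \<kappa>"
    and ind: "indep_vars (\<lambda>_. N) \<zeta> UNIV"
    and ident: "\<And>s. distr M N (\<zeta> s) = distr M N (\<zeta> 0)"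
    and g_pos: "\<And>z a b \<epsilon>. 0 < g z a b \<epsilon>"
    and g_cont: "\<And>z a b. continuous_on UNIV (g z a b)"
    and g_meas [measurable]: "\<And>a b \<epsilon>. (\<lambda>z. g z a b \<epsilon>) \<in> borel_measurable N"
  defines "\<Lambda> \<equiv> \<lambda>n a \<epsilon> \<omega>. weighted_cond_exp (\<lambda>\<omega> s c. g (\<zeta> s \<omega>) (E s \<omega>) c \<epsilon>) n a \<omega> /
      weighted_cond_exp (\<lambda>\<omega> s c. g (\<zeta> s \<omega>) (E s \<omega>) c \<epsilon>) n i \<omega>"
  defines "L \<equiv> \<lambda>a \<epsilon> \<omega>. lim (\<lambda>n. \<Lambda> n a \<epsilon> \<omega>)"
  shows "\<exists>S :: nat \<Rightarrow> real. (\<forall>k. 0 < S k \<and> S k < 1) \<and>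
    (AE \<omega> in M. \<forall>a.
       (\<forall>K. compact K \<longrightarrow> uniform_limit K (\<lambda>n \<epsilon>. \<Lambda> n a \<epsilon> \<omega>) (\<lambda>\<epsilon>. L a \<epsilon> \<omega>) sequentially) \<and>
       (\<forall>\<epsilon>. L a \<epsilon> \<omega> > 0) \<and> continuous_on UNIV (\<lambda>\<epsilon>. L a \<epsilon> \<omega>) \<and>
       (\<forall>k \<epsilon>0 r. 0 < \<epsilon>0 \<longrightarrow> \<epsilon>0 \<le> real k \<longrightarrow> S k \<le> r \<longrightarrow> r < 1 \<longrightarrow>
          (\<lambda>n. SUP \<epsilon>\<in>cball 0 \<epsilon>0. \<bar>\<Lambda> n a \<epsilon> \<omega> - L a \<epsilon> \<omega>\<bar>) \<in> o(\<lambda>n. r ^ n)))"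
proof -
  define \<psi> where "\<psi> \<epsilon> \<omega> s c = g (\<zeta> s \<omega>) (E s \<omega>) c \<epsilon>" for \<epsilon> \<omega> s c
  have kernel: "weighted_kernel p (\<psi> \<epsilon> \<omega>)" for \<epsilon> \<omega>
    by standard (simp_all add: p_nonneg p_sum \<psi>_def g_pos)
  define Num where "Num \<epsilon> \<omega> n a = weighted_kernel.N p (\<psi> \<epsilon> \<omega>) n a" for \<epsilon> \<omega> n a
  have Num: "weighted_cond_exp (\<lambda>\<omega> s c. g (\<zeta> s \<omega>) (E s \<omega>) c \<epsilon>) n a \<omega> = Num \<epsilon> \<omega> n a" for \<epsilon> n a \<omega>
    using cond_expectation_weighted_path[where a = a and n = n and \<psi> = "\<psi> \<epsilon> \<omega>"]
    unfolding weighted_cond_exp_def Num_def weighted_kernel.N_def[OF kernel] weighted_kernel.T_def[OF kernel, abs_def]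
    by (simp only: \<psi>_def)
  have \<Lambda>: "\<Lambda> n a \<epsilon> \<omega> = Num \<epsilon> \<omega> n a / Num \<epsilon> \<omega> n i" for n a \<epsilon> \<omega>
    by (simp only: \<Lambda>_def Num)
  have Num_pos: "0 < Num \<epsilon> \<omega> n a" for \<epsilon> \<omega> n a
    unfolding Num_def by (rule weighted_kernel.N_pos[OF kernel])
  have Num_cont: "continuous_on UNIV (\<lambda>\<epsilon>. Num \<epsilon> \<omega> n a)" for \<omega> n a
  proof -
    have "continuous_on UNIV (\<lambda>\<epsilon>. mprod (\<lambda>s a b. p s a b * \<psi> \<epsilon> \<omega> (Suc s) b) m n a b)" for m n a b
      by (induction n arbitrary: b) (auto simp: \<psi>_def intro!: continuous_intros g_cont)
    then show ?thesis
      unfolding Num_def weighted_kernel.N_def[OF kernel] weighted_kernel.T_def[OF kernel, abs_def]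
      by (intro continuous_on_sum)
  qed
  have \<Lambda>_cont: "continuous_on UNIV (\<lambda>\<epsilon>. \<Lambda> n a \<epsilon> \<omega>)" for n a \<omega>
    unfolding \<Lambda> by (intro continuous_on_divide Num_cont) (simp add: Num_pos less_imp_neq[THEN not_sym])

  \<comment> \<open>One function of three states: \<open>a\<close> for the hidden state of the data, \<open>b\<close> and \<open>c\<close> for the states whose weights are compared.\<close>
  define h where "h z j \<epsilon> = (case j of (a, b, c) \<Rightarrow> g z a b \<epsilon> / g z a c \<epsilon>)" for z j \<epsilon>
  have h_cont: "continuous_on UNIV (h z j)" for z j
    unfolding h_def[abs_def]
    by (cases j) (auto intro!: continuous_on_divide g_cont simp: g_pos less_imp_neq[THEN not_sym])
  have h_meas: "(\<lambda>z. h z j \<epsilon>) \<in> borel_measurable N" for j \<epsilon>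
    unfolding h_def by (cases j) simp
  have h_pos: "0 < h z j \<epsilon>" for z j \<epsilon>
    unfolding h_def by (cases j) (simp add: g_pos)
  have "\<forall>k. \<exists>v\<in>borel_measurable N. (\<forall>z. 0 < v z) \<and> (\<forall>z j. \<forall>\<epsilon>\<in>cball 0 (real k). v z \<le> h z j \<epsilon>)"
    by (intro allI measurable_positive_lower_bound h_meas h_cont h_pos compact_cball) simp
  then obtain v where v_all: "\<forall>k. v k \<in> borel_measurable N \<and> (\<forall>z. 0 < v k z) \<and>
      (\<forall>z j. \<forall>\<epsilon>\<in>cball 0 (real k). v k z \<le> h z j \<epsilon>)"
    unfolding Bex_def choice_iff by (elim exE)
  then have v: "v k \<in> borel_measurable N" "0 < v k z" for k z
    by blast+
  have v_osc': "v k z \<le> g z a b \<epsilon> / g z a c \<epsilon>" if "\<epsilon> \<in> cball 0 (real k)" for k z a b c \<epsilon>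
  proof -
    have "v k z \<le> h z (a, b, c) \<epsilon>" using v_all that by blast
    then show ?thesis by (simp add: h_def)
  qed
  have v_osc: "v k z * g z a c \<epsilon> \<le> g z a b \<epsilon>" if "\<epsilon> \<in> cball 0 (real k)" for k z a b c \<epsilon>
    using v_osc'[OF that, of z a b c] g_pos[of z a c \<epsilon>] by (simp add: pos_le_divide_eq)
  have v_le_1: "v k z \<le> 1" for k z
    using v_osc'[of 0 k z i i i] g_pos[of z i i 0] by simp
  have "\<delta> \<le> mprod p 0 \<kappa> i i" unfolding mprod_p_eq_cond_prob by (rule mix(2))
  also have "\<dots> \<le> 1" by (rule weighted_kernel.mprod_p_le_1[OF kernel])
  finally have \<delta>_le_1: "\<delta> \<le> 1" .

  define w where "w k \<omega> s = v k (\<zeta> s \<omega>)" for k \<omega> s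
  define \<rho> where "\<rho> k \<omega> j = \<delta> * (\<Prod>s=Suc (j * \<kappa>)..j * \<kappa> + \<kappa>. w k \<omega> s)" for k \<omega> j
  define D where "D k \<omega> J = (1 / \<rho> k \<omega> 0) * (\<Prod>j=1..J. 1 - \<rho> k \<omega> j)" for k \<omega> J
  have mixing: "mixing_kernel p (\<psi> \<epsilon> \<omega>) \<kappa> \<delta> (w k \<omega>)" if "\<epsilon> \<in> cball 0 (real k)" for k \<epsilon> \<omega>
    using kernel mix v_osc[OF that]
    by (simp add: mixing_kernel_def mixing_kernel_axioms_def mprod_p_eq_cond_prob w_def v v_le_1 \<psi>_def)
  have \<rho>_eq: "mixing_kernel.\<rho> \<kappa> \<delta> (w k \<omega>) = \<rho> k \<omega>" for k \<omega>
    using mixing_kernel.\<rho>_def[OF mixing[of 0 k \<omega>]] by (simp add: fun_eq_iff \<rho>_def)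
  have \<rho>_pos: "0 < \<rho> k \<omega> j" for k \<omega> j
    using mixing_kernel.\<rho>_pos[OF mixing[of 0 k \<omega>]] by (simp add: \<rho>_eq)

  have "\<forall>k. \<exists>t. 0 < t \<and> t < 1 \<and> (AE \<omega> in M. (\<lambda>J. (\<Prod>j=1..J. 1 - \<rho> k \<omega> j) / t ^ J) \<longlonglongrightarrow> 0)"
    unfolding \<rho>_def w_def
    by (rule allI, rule AE_iid_block_product_decay[OF ind ident v v_le_1 mix(1) \<delta>_le_1])
  then obtain t where "\<forall>k. 0 < t k \<and> t k < 1 \<and>
      (AE \<omega> in M. (\<lambda>J. (\<Prod>j=1..J. 1 - \<rho> k \<omega> j) / t k ^ J) \<longlonglongrightarrow> 0)"
    unfolding choice_iff by (elim exE)
  then have t: "0 < t k" "t k < 1"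
    and AE_t: "AE \<omega> in M. (\<lambda>J. (\<Prod>j=1..J. 1 - \<rho> k \<omega> j) / t k ^ J) \<longlonglongrightarrow> 0" for k
    by blast+
  \<comment> \<open>The decay \<open>t k\<close> per block of length \<open>\<kappa>\<close> amounts to its \<open>\<kappa>\<close>-th root per unit of time.\<close>
  define S where "S k = root \<kappa> (t k)" for k
  have S: "0 < S k" "S k < 1" "S k ^ \<kappa> = t k" for k
    using t[of k] \<open>0 < \<kappa>\<close> by (simp_all add: S_def real_root_lt_1_iff)
  show ?thesis
  proof (intro exI[of _ S] conjI allI S)
    have "AE \<omega> in M. \<forall>k. (\<lambda>J. (\<Prod>j=1..J. 1 - \<rho> k \<omega> j) / t k ^ J) \<longlonglongrightarrow> 0"
      using AE_t by (simp add: AE_all_countable)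
    then show "AE \<omega> in M. \<forall>a.
       (\<forall>K. compact K \<longrightarrow> uniform_limit K (\<lambda>n \<epsilon>. \<Lambda> n a \<epsilon> \<omega>) (\<lambda>\<epsilon>. L a \<epsilon> \<omega>) sequentially) \<and>
       (\<forall>\<epsilon>. L a \<epsilon> \<omega> > 0) \<and> continuous_on UNIV (\<lambda>\<epsilon>. L a \<epsilon> \<omega>) \<and>
       (\<forall>k \<epsilon>0 r. 0 < \<epsilon>0 \<longrightarrow> \<epsilon>0 \<le> real k \<longrightarrow> S k \<le> r \<longrightarrow> r < 1 \<longrightarrow>
          (\<lambda>n. SUP \<epsilon>\<in>cball 0 \<epsilon>0. \<bar>\<Lambda> n a \<epsilon> \<omega> - L a \<epsilon> \<omega>\<bar>) \<in> o(\<lambda>n. r ^ n))"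
    proof eventually_elim
      case (elim \<omega>)
      have Dt: "(\<lambda>J. D k \<omega> J / t k ^ J) \<longlonglongrightarrow> 0" for k
        using tendsto_mult[OF tendsto_const[of "1 / \<rho> k \<omega> 0"] elim[rule_format, of k]]
        by (simp add: D_def)
      have D0: "D k \<omega> \<longlonglongrightarrow> 0" for k
      proof -
        have "(\<lambda>J. D k \<omega> J / t k ^ J * t k ^ J) \<longlonglongrightarrow> 0 * 0"
          using t[of k] by (intro tendsto_mult Dt LIMSEQ_power_zero) auto
        then show ?thesis using t[of k] by simp
      qed
      show ?case
      proof (intro allI)
        fix a
        have ge: "\<forall>k. \<forall>\<epsilon>\<in>cball 0 (real k). \<forall>n\<ge>\<kappa>. \<rho> k \<omega> 0 \<le> \<Lambda> n a \<epsilon> \<omega>"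
          using mixing_kernel.N_ratio_ge[OF mixing] unfolding \<rho>_eq \<Lambda> Num_def by blast
        have dist: "\<forall>k J. \<forall>\<epsilon>\<in>cball 0 (real k). \<forall>n\<ge>Suc J * \<kappa>. \<forall>m\<ge>Suc J * \<kappa>.
            \<bar>\<Lambda> n a \<epsilon> \<omega> - \<Lambda> m a \<epsilon> \<omega>\<bar> \<le> D k \<omega> J"
          using mixing_kernel.N_ratio_dist[OF mixing] unfolding \<rho>_eq \<Lambda> Num_def D_def by blast
        have L_eq: "L a \<epsilon> \<omega> = lim (\<lambda>n. \<Lambda> n a \<epsilon> \<omega>)" for \<epsilon> by (simp only: L_def)
        note * = locally_uniform_limit_from_bound[where \<Lambda> = "\<lambda>n \<epsilon>. \<Lambda> n a \<epsilon> \<omega>" and c = "\<lambda>k. \<rho> k \<omega> 0"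
            and D = "\<lambda>k. D k \<omega>" and \<kappa> = \<kappa>, OF \<Lambda>_cont \<rho>_pos ge D0 dist, folded L_eq]
        have rate: "(\<lambda>n. SUP \<epsilon>\<in>cball 0 \<epsilon>0. \<bar>\<Lambda> n a \<epsilon> \<omega> - L a \<epsilon> \<omega>\<bar>) \<in> o(\<lambda>n. r ^ n)"
          if "0 < \<epsilon>0" "\<epsilon>0 \<le> real k" "S k \<le> r" "r < 1" for k \<epsilon>0 r
        proof (rule block_rate_smallo[OF Dt[of k] t(1)[of k] \<open>0 < \<kappa>\<close> _ \<open>r < 1\<close>])
          show "0 < r" using S(1)[of k] that by linarith
          show "t k \<le> r ^ \<kappa>"
            using power_mono[OF \<open>S k \<le> r\<close> less_imp_le[OF S(1)], of \<kappa>] by (simp add: S(3))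
          fix n J assume n: "n \<ge> Suc J * \<kappa>"
          have le: "\<bar>\<Lambda> n a \<epsilon> \<omega> - L a \<epsilon> \<omega>\<bar> \<le> D k \<omega> J" if "\<epsilon> \<in> cball 0 \<epsilon>0" for \<epsilon>
            using *(4)[OF _ n] that \<open>\<epsilon>0 \<le> real k\<close> by auto
          have "0 \<le> \<bar>\<Lambda> n a 0 \<omega> - L a 0 \<omega>\<bar>" by simp
          also have "\<dots> \<le> (SUP \<epsilon>\<in>cball 0 \<epsilon>0. \<bar>\<Lambda> n a \<epsilon> \<omega> - L a \<epsilon> \<omega>\<bar>)"
            using \<open>0 < \<epsilon>0\<close> le by (intro cSUP_upper bdd_aboveI[of _ "D k \<omega> J"]) auto
          moreover have "(SUP \<epsilon>\<in>cball 0 \<epsilon>0. \<bar>\<Lambda> n a \<epsilon> \<omega> - L a \<epsilon> \<omega>\<bar>) \<le> D k \<omega> J"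
            using \<open>0 < \<epsilon>0\<close> le by (intro cSUP_least) auto
          ultimately show "\<bar>SUP \<epsilon>\<in>cball 0 \<epsilon>0. \<bar>\<Lambda> n a \<epsilon> \<omega> - L a \<epsilon> \<omega>\<bar>\<bar> \<le> D k \<omega> J" by linarith
        qed
        show "(\<forall>K. compact K \<longrightarrow> uniform_limit K (\<lambda>n \<epsilon>. \<Lambda> n a \<epsilon> \<omega>) (\<lambda>\<epsilon>. L a \<epsilon> \<omega>) sequentially) \<and>
         (\<forall>\<epsilon>. L a \<epsilon> \<omega> > 0) \<and> continuous_on UNIV (\<lambda>\<epsilon>. L a \<epsilon> \<omega>) \<and>
         (\<forall>k \<epsilon>0 r. 0 < \<epsilon>0 \<longrightarrow> \<epsilon>0 \<le> real k \<longrightarrow> S k \<le> r \<longrightarrow> r < 1 \<longrightarrow>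
            (\<lambda>n. SUP \<epsilon>\<in>cball 0 \<epsilon>0. \<bar>\<Lambda> n a \<epsilon> \<omega> - L a \<epsilon> \<omega>\<bar>) \<in> o(\<lambda>n. r ^ n))"
          by (intro conjI allI impI; (rule *(1) *(2) *(3) rate; assumption)?)
      qed
    qed
  qed
qed

end

section \<open>Transfer of the Markov property and time reversal\<close>

lemma prob_path_eq_of_distr_eq:
  fixes X Y :: "int \<Rightarrow> 'w \<Rightarrow> 'h::finite"
  assumes distr: "distr M (PiM UNIV (\<lambda>_. count_space UNIV)) (\<lambda>\<omega> t. X t \<omega>) =
      distr M (PiM UNIV (\<lambda>_. count_space UNIV)) (\<lambda>\<omega> t. Y t \<omega>)"
    and X: "\<And>t. X t \<in> measurable M (count_space UNIV)" and Y: "\<And>t. Y t \<in> measurable M (count_space UNIV)"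
    and P: "Measurable.pred (PiM UNIV (\<lambda>_. count_space UNIV)) P"
  shows "measure M {\<omega> \<in> space M. P (\<lambda>t. X t \<omega>)} = measure M {\<omega> \<in> space M. P (\<lambda>t. Y t \<omega>)}"
proof -
  let ?S = "PiM UNIV (\<lambda>_. count_space UNIV) :: (int \<Rightarrow> 'h) measure"
  have set: "{y \<in> space ?S. P y} \<in> sets ?S" using P by measurable
  have "measure M {\<omega> \<in> space M. P (\<lambda>t. W t \<omega>)} = measure (distr M ?S (\<lambda>\<omega> t. W t \<omega>)) {y \<in> space ?S. P y}"
    if "\<And>t. W t \<in> measurable M (count_space UNIV)" for W :: "int \<Rightarrow> 'w \<Rightarrow> 'h"
  proof -
    have "(\<lambda>\<omega> t. W t \<omega>) \<in> measurable M ?S"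
      by (rule measurable_PiM_single') (use that in \<open>auto simp: PiE_def\<close>)
    then show ?thesis
      by (subst measure_distr[OF _ set]) (auto simp: space_PiM intro!: arg_cong[where f = "measure M"])
  qed
  from this[OF X] this[OF Y] show ?thesis by (simp add: distr)
qed

lemma cond_prob_eq_of_distr_eq:
  fixes X Y :: "int \<Rightarrow> 'w \<Rightarrow> 'h::finite"
  assumes distr: "distr M (PiM UNIV (\<lambda>_. count_space UNIV)) (\<lambda>\<omega> t. X t \<omega>) =
      distr M (PiM UNIV (\<lambda>_. count_space UNIV)) (\<lambda>\<omega> t. Y t \<omega>)"
    and X: "\<And>t. X t \<in> measurable M (count_space UNIV)" and Y: "\<And>t. Y t \<in> measurable M (count_space UNIV)"
  shows "\<P>(\<omega> in M. X t \<omega> = b \<bar> X s \<omega> = a) = \<P>(\<omega> in M. Y t \<omega> = b \<bar> Y s \<omega> = a)"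
  unfolding cond_prob_def
  by (intro arg_cong2[where f = "(/)"] prob_path_eq_of_distr_eq[OF distr X Y, where P = "\<lambda>y. y t = b \<and> y s = a"]
      prob_path_eq_of_distr_eq[OF distr X Y, where P = "\<lambda>y. y s = a"]) measurable

lemma markov_chain_of_distr_eq:
  fixes X Y :: "int \<Rightarrow> 'w \<Rightarrow> 'h::finite"
  assumes distr: "distr M (PiM UNIV (\<lambda>_. count_space UNIV)) (\<lambda>\<omega> t. X t \<omega>) =
      distr M (PiM UNIV (\<lambda>_. count_space UNIV)) (\<lambda>\<omega> t. Y t \<omega>)"
    and X: "\<And>t. X t \<in> measurable M (count_space UNIV)" and Y: "markov_chain M Y"
  shows "markov_chain M X"
proof -
  have Ym: "Y t \<in> measurable M (count_space UNIV)" for t using Y by (simp add: markov_chain_def)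
  note eq = prob_path_eq_of_distr_eq[OF distr X Ym]
  have path: "measure M {\<omega> \<in> space M. \<forall>s\<in>{t - int n..t}. X s \<omega> = x s} =
      measure M {\<omega> \<in> space M. \<forall>s\<in>{t - int n..t}. Y s \<omega> = x s}" for t n x
    by (rule eq[where P = "\<lambda>y. \<forall>s\<in>{t - int n..t}. y s = x s"]) measurable
  have "\<P>(\<omega> in M. X (t + 1) \<omega> = b \<bar> (\<forall>s\<in>{t - int n..t}. X s \<omega> = x s)) =
      \<P>(\<omega> in M. Y (t + 1) \<omega> = b \<bar> (\<forall>s\<in>{t - int n..t}. Y s \<omega> = x s))" for t n x b
    unfolding cond_prob_def path
    by (intro arg_cong2[where f = "(/)"] refl
      eq[where P = "\<lambda>y. y (t + 1) = b \<and> (\<forall>s\<in>{t - int n..t}. y s = x s)"]) measurable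
  then show ?thesis
    using Y X cond_prob_eq_of_distr_eq[OF distr X Ym] unfolding markov_chain_def path by simp
qed

text \<open>If the initial path has probability \<open>0\<close>, both sides vanish.\<close>

lemma markov_chain_extend:
  fixes X :: "int \<Rightarrow> 'w \<Rightarrow> 'h::finite"
  assumes "prob_space M" "markov_chain M X" and u: "u \<le> t"
  shows "measure M {\<omega> \<in> space M. (\<forall>s\<in>{u..t}. X s \<omega> = x s) \<and> X (t + 1) \<omega> = b} =
    measure M {\<omega> \<in> space M. \<forall>s\<in>{u..t}. X s \<omega> = x s} * \<P>(\<omega> in M. X (t + 1) \<omega> = b \<bar> X t \<omega> = x t)"
proof -
  interpret prob_space M by fact
  have X [measurable]: "X s \<in> measurable M (count_space UNIV)" for s
    using assms(2) by (simp add: markov_chain_def)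
  let ?A = "{\<omega> \<in> space M. \<forall>s\<in>{u..t}. X s \<omega> = x s}"
  let ?B = "{\<omega> \<in> space M. (\<forall>s\<in>{u..t}. X s \<omega> = x s) \<and> X (t + 1) \<omega> = b}"
  have A: "?A \<in> sets M" by measurable
  have "t - int (nat (t - u)) = u" using u by simp
  then obtain n where n: "t - int n = u" by blast
  show ?thesis
  proof (cases "prob ?A > 0")
    case True
    have "\<P>(\<omega> in M. X (t + 1) \<omega> = b \<bar> (\<forall>s\<in>{u..t}. X s \<omega> = x s)) =
        \<P>(\<omega> in M. X (t + 1) \<omega> = b \<bar> X t \<omega> = x t)"
      using assms(2)[unfolded markov_chain_def, THEN conjunct2, rule_format, of t n x b] True by (simp add: n)
    then show ?thesis using True by (simp add: cond_prob_def[of M _ "\<lambda>\<omega>. \<forall>s\<in>{u..t}. X s \<omega> = x s"] conj_commute field_simps)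
  next
    case False
    then have "prob ?A = 0" by (simp add: zero_less_measure_iff)
    moreover have "prob ?B \<le> prob ?A" by (intro finite_measure_mono A) auto
    ultimately show ?thesis using measure_nonneg[of M ?B] by simp
  qed
qed

text \<open>The Markov property of the reversed chain: conditionally on \<open>X u\<close>, the state at \<open>u - 1\<close> is independent
of the path after \<open>u\<close>. Each forward step multiplies both sides by the same transition probability.\<close>

lemma markov_chain_extend_back:
  fixes X :: "int \<Rightarrow> 'w \<Rightarrow> 'h::finite"
  assumes "prob_space M" "markov_chain M X"
  shows "measure M {\<omega> \<in> space M. X (u - 1) \<omega> = b \<and> (\<forall>s\<in>{u..u + int k}. X s \<omega> = x s)} * measure M {\<omega> \<in> space M. X u \<omega> = x u} =
    measure M {\<omega> \<in> space M. X (u - 1) \<omega> = b \<and> X u \<omega> = x u} * measure M {\<omega> \<in> space M. \<forall>s\<in>{u..u + int k}. X s \<omega> = x s}"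
proof (induction k)
  case 0
  show ?case by simp
next
  case (Suc k)
  let ?t = "u + int k"
  let ?c = "\<P>(\<omega> in M. X (?t + 1) \<omega> = x (?t + 1) \<bar> X ?t \<omega> = x ?t)"
  have split: "(\<forall>s\<in>{u..u + int (Suc k)}. X s \<omega> = x s) \<longleftrightarrow> (\<forall>s\<in>{u..?t}. X s \<omega> = x s) \<and> X (?t + 1) \<omega> = x (?t + 1)" for \<omega>
  proof -
    have "{u..u + int (Suc k)} = insert (?t + 1) {u..?t}" by auto
    then show ?thesis by auto
  qed
  \<comment> \<open>The path with \<open>b\<close> put in front at time \<open>u - 1\<close>, to which the forward step is applied.\<close>
  have path_back: "(\<forall>s\<in>{u - 1..?t}. X s \<omega> = (x(u - 1 := b)) s) \<longleftrightarrow> X (u - 1) \<omega> = b \<and> (\<forall>s\<in>{u..?t}. X s \<omega> = x s)" for \<omega>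
  proof -
    have "{u - 1..?t} = insert (u - 1) {u..?t}" by auto
    then show ?thesis by auto
  qed
  have 1: "measure M {\<omega> \<in> space M. X (u - 1) \<omega> = b \<and> (\<forall>s\<in>{u..u + int (Suc k)}. X s \<omega> = x s)} =
      measure M {\<omega> \<in> space M. X (u - 1) \<omega> = b \<and> (\<forall>s\<in>{u..?t}. X s \<omega> = x s)} * ?c"
    using markov_chain_extend[OF assms, of "u - 1" ?t "x(u - 1 := b)" "x (?t + 1)"]
    unfolding split path_back by (simp add: conj_assoc)
  have 2: "measure M {\<omega> \<in> space M. \<forall>s\<in>{u..u + int (Suc k)}. X s \<omega> = x s} =
      measure M {\<omega> \<in> space M. \<forall>s\<in>{u..?t}. X s \<omega> = x s} * ?c"
    unfolding split by (rule markov_chain_extend[OF assms]) simp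
  show ?case unfolding 1 2 using Suc.IH by (simp add: mult_ac)
qed

lemma positive_markov_forward:
  fixes X :: "int \<Rightarrow> 'w \<Rightarrow> 'h::finite"
  assumes "prob_space M" "markov_chain M X" and pos: "\<And>t a. 0 < measure M {\<omega> \<in> space M. X t \<omega> = a}"
  shows "positive_markov M (\<lambda>s. X (int s))"
proof -
  have path: "(\<forall>s\<in>{0..int n}. X s \<omega> = x (nat s)) \<longleftrightarrow> (\<forall>s\<le>n. X (int s) \<omega> = x s)" for n x \<omega>
  proof
    assume *: "\<forall>s\<in>{0..int n}. X s \<omega> = x (nat s)"
    show "\<forall>s\<le>n. X (int s) \<omega> = x s"
    proof (intro allI impI)
      fix s assume "s \<le> n"
      then show "X (int s) \<omega> = x s" using *[rule_format, of "int s"] by simp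
    qed
  next
    assume *: "\<forall>s\<le>n. X (int s) \<omega> = x s"
    show "\<forall>s\<in>{0..int n}. X s \<omega> = x (nat s)"
      using * by (auto simp: nat_le_iff dest: spec[of _ "nat _"])
  qed
  have "measure M {\<omega> \<in> space M. (\<forall>s\<le>n. X (int s) \<omega> = x s) \<and> X (int (Suc n)) \<omega> = c} =
    measure M {\<omega> \<in> space M. \<forall>s\<le>n. X (int s) \<omega> = x s} *
    \<P>(\<omega> in M. X (int (Suc n)) \<omega> = c \<bar> X (int n) \<omega> = x n)" for n x c
    using markov_chain_extend[OF assms(1,2), of 0 "int n" "\<lambda>s. x (nat s)" c] unfolding path
    by (simp add: add.commute)
  then show ?thesis
    using assms unfolding positive_markov_def positive_markov_axioms_def markov_chain_def by blast
qed

lemma positive_markov_backward: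
  fixes X :: "int \<Rightarrow> 'w \<Rightarrow> 'h::finite"
  assumes "prob_space M" "markov_chain M X" and pos: "\<And>t a. 0 < measure M {\<omega> \<in> space M. X t \<omega> = a}"
  shows "positive_markov M (\<lambda>s. X (- int s))"
proof -
  have path: "(\<forall>s\<in>{- int n..- int n + int n}. X s \<omega> = x (nat (- s))) \<longleftrightarrow> (\<forall>s\<le>n. X (- int s) \<omega> = x s)" for n x \<omega>
  proof
    assume *: "\<forall>s\<in>{- int n..- int n + int n}. X s \<omega> = x (nat (- s))"
    show "\<forall>s\<le>n. X (- int s) \<omega> = x s"
    proof (intro allI impI)
      fix s assume "s \<le> n"
      then show "X (- int s) \<omega> = x s" using *[rule_format, of "- int s"] by simp
    qed
  next
    assume *: "\<forall>s\<le>n. X (- int s) \<omega> = x s"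
    show "\<forall>s\<in>{- int n..- int n + int n}. X s \<omega> = x (nat (- s))"
    proof
      fix s assume "s \<in> {- int n..- int n + int n}"
      then show "X s \<omega> = x (nat (- s))" using *[rule_format, of "nat (- s)"] by auto
    qed
  qed
  have "measure M {\<omega> \<in> space M. (\<forall>s\<le>n. X (- int s) \<omega> = x s) \<and> X (- int (Suc n)) \<omega> = c} =
    measure M {\<omega> \<in> space M. \<forall>s\<le>n. X (- int s) \<omega> = x s} *
    \<P>(\<omega> in M. X (- int (Suc n)) \<omega> = c \<bar> X (- int n) \<omega> = x n)" for n x c
  proof -
    have S: "- int (Suc n) = - int n - 1" by simp
    show ?thesis
      using markov_chain_extend_back[OF assms(1,2), of "- int n" c n "\<lambda>s. x (nat (- s))"] pos[of "- int n" "x n"]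
      unfolding path S by (simp add: cond_prob_def conj_commute field_simps)
  qed
  then show ?thesis
    using assms unfolding positive_markov_def positive_markov_axioms_def markov_chain_def by blast
qed

section \<open>The two-sided theorem\<close>

text \<open>Running maxima make the rates monotone in the integer radius. Dividing the gap \<open>1 - T\<close> by \<open>1 + x\<close> then makes
them strictly increasing without reaching \<open>1\<close>.\<close>

lemma strict_mono_rate_above:
  fixes S :: "nat \<Rightarrow> real"
  assumes S: "\<And>k. 0 < S k" "\<And>k. S k < 1"
  obtains r :: "real \<Rightarrow> real" where "strict_mono_on {0<..} r" "\<And>x. 0 < x \<Longrightarrow> 0 < r x \<and> r x < 1"
    "\<And>x. 0 < x \<Longrightarrow> S (nat \<lceil>x\<rceil>) \<le> r x"
proof -
  define T where "T k = Max (S ` {..k})" for k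
  have T_ge: "S j \<le> T k" if "j \<le> k" for j k
    unfolding T_def using that by (intro Max_ge) auto
  have T01: "0 < T k" "T k < 1" for k
    using S less_le_trans[OF S(1) T_ge[of 0 k]] by (auto simp: T_def)
  have T_mono: "T j \<le> T k" if "j \<le> k" for j k
    unfolding T_def using that by (intro Max_mono) auto
  define r where "r x = 1 - (1 - T (nat \<lceil>x\<rceil>)) / (1 + x)" for x
  have T_le_r: "T (nat \<lceil>x\<rceil>) \<le> r x" if "0 < x" for x
  proof -
    have "(1 - T (nat \<lceil>x\<rceil>)) / (1 + x) \<le> (1 - T (nat \<lceil>x\<rceil>)) / 1"
      using that T01[of "nat \<lceil>x\<rceil>"] by (intro divide_left_mono) auto
    then show ?thesis by (simp add: r_def)
  qed
  show thesis
  proof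
    show "strict_mono_on {0<..} r"
    proof (rule strict_mono_onI)
      fix x y :: real assume xy: "x \<in> {0<..}" "y \<in> {0<..}" "x < y"
      have "(1 - T (nat \<lceil>y\<rceil>)) / (1 + y) < (1 - T (nat \<lceil>y\<rceil>)) / (1 + x)"
        using xy T01 by (intro divide_strict_left_mono) auto
      also have "\<dots> \<le> (1 - T (nat \<lceil>x\<rceil>)) / (1 + x)"
        using xy T_mono[OF nat_mono[OF ceiling_mono[of x y]]] by (intro divide_right_mono) auto
      finally show "r x < r y" by (simp add: r_def)
    qed
    show "S (nat \<lceil>x\<rceil>) \<le> r x" if "0 < x" for x
      using T_ge[of "nat \<lceil>x\<rceil>" "nat \<lceil>x\<rceil>"] T_le_r[OF that] by simp
    show "0 < r x \<and> r x < 1" if "0 < x" for x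
      using less_le_trans[OF T01(1) T_le_r[OF that]] that T01(2) by (simp add: r_def)
  qed
qed

theorem theorem2p2:
  fixes M :: "'w measure"
    and H0 H1 :: "'h::finite set"
    and \<eta> \<sigma> :: "int \<Rightarrow> 'w \<Rightarrow> 'h"
    and Z :: "int \<Rightarrow> 'w \<Rightarrow> 'z::euclidean_space"
    and \<Theta> :: "(real ^ 'd) set"
    and \<phi> :: "'z \<Rightarrow> real ^ 'd \<Rightarrow> 'x::euclidean_space"
    and f :: "'x \<Rightarrow> real ^ 'd \<Rightarrow> ennreal"
    and \<theta> :: "'h \<Rightarrow> real ^ 'p \<Rightarrow> real ^ 'd"
    and i :: 'h
  defines "\<Lambda> \<equiv> Lambda M f \<phi> \<theta> Z \<eta> \<sigma> i"
  defines "L \<equiv> (\<lambda>a \<epsilon> \<omega>. lim (\<lambda>n. \<Lambda> (int n) a \<epsilon> \<omega>))"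
  defines "Lbar \<equiv> (\<lambda>a \<epsilon> \<omega>. lim (\<lambda>n. \<Lambda> (- int n) a \<epsilon> \<omega>))"
  assumes "prob_space M"
    and "H0 \<union> H1 = UNIV" "H0 \<inter> H1 = {}" "H0 \<noteq> {}" "H1 \<noteq> {}"
    and "open \<Theta>"
    and "\<And>a \<epsilon>. \<theta> a \<epsilon> \<in> \<Theta>"
    and "\<And>v. v \<in> \<Theta> \<Longrightarrow> (\<lambda>z. \<phi> z v) \<in> borel_measurable borel"
    and sigma_copy: "\<And>t. \<sigma> t \<in> measurable M (count_space UNIV)"
      "distr M (PiM UNIV (\<lambda>_. count_space UNIV)) (\<lambda>\<omega> t. \<sigma> t \<omega>) =
       distr M (PiM UNIV (\<lambda>_. count_space UNIV)) (\<lambda>\<omega> t. \<eta> t \<omega>)"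
      "indep_rv M
         (PiM UNIV (\<lambda>_. count_space UNIV)) (\<lambda>\<omega> t. \<sigma> t \<omega>)
         (PiM UNIV (\<lambda>_. count_space UNIV) \<Otimes>\<^sub>M PiM UNIV (\<lambda>_. borel)) (\<lambda>\<omega>. (\<lambda>t. \<eta> t \<omega>, \<lambda>t. Z t \<omega>))"
    and A1: "indep_rv M
         (PiM UNIV (\<lambda>_. borel)) (\<lambda>\<omega> t. Z t \<omega>)
         (PiM UNIV (\<lambda>_. count_space UNIV)) (\<lambda>\<omega> t. \<eta> t \<omega>)"
      "prob_space.indep_vars M (\<lambda>_. borel) Z UNIV"
      "\<And>s t. distr M borel (Z s) = distr M borel (Z t)"
      "\<And>v t. v \<in> \<Theta> \<Longrightarrow> distributed M lborel (\<lambda>\<omega>. \<phi> (Z t \<omega>) v) (\<lambda>x. f x v)"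
    and A2: "markov_chain M \<eta>"
      "\<exists>(\<kappa>::nat) (\<phi>s::real). \<kappa> \<ge> 1 \<and> \<phi>s > 0 \<and>
         (\<forall>a b s t. \<bar>s - t\<bar> \<ge> int \<kappa> \<longrightarrow> \<P>(\<omega> in M. \<eta> t \<omega> = b \<bar> \<eta> s \<omega> = a) \<ge> \<phi>s)"
    and A3: "\<And>z a b \<epsilon>. 0 < f (\<phi> z (\<theta> a \<epsilon>)) (\<theta> b \<epsilon>) \<and> f (\<phi> z (\<theta> a \<epsilon>)) (\<theta> b \<epsilon>) < \<infinity>"
      "\<And>z a b. continuous_on UNIV (\<lambda>\<epsilon>. f (\<phi> z (\<theta> a \<epsilon>)) (\<theta> b \<epsilon>))"
  shows "(AE \<omega> in M. \<forall>a.
            (\<forall>K. compact K \<longrightarrow>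
               uniform_limit K (\<lambda>n \<epsilon>. \<Lambda> (int n) a \<epsilon> \<omega>) (\<lambda>\<epsilon>. L a \<epsilon> \<omega>) sequentially \<and>
               uniform_limit K (\<lambda>n \<epsilon>. \<Lambda> (- int n) a \<epsilon> \<omega>) (\<lambda>\<epsilon>. Lbar a \<epsilon> \<omega>) sequentially) \<and>
            (\<forall>\<epsilon>. L a \<epsilon> \<omega> > 0) \<and> continuous_on UNIV (\<lambda>\<epsilon>. L a \<epsilon> \<omega>) \<and>
            (\<forall>\<epsilon>. Lbar a \<epsilon> \<omega> > 0) \<and> continuous_on UNIV (\<lambda>\<epsilon>. Lbar a \<epsilon> \<omega>)) \<and>
         (\<exists>r :: real \<Rightarrow> real.
            strict_mono_on {0<..} r \<and> (\<forall>\<epsilon>0>0. 0 < r \<epsilon>0 \<and> r \<epsilon>0 < 1) \<and>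
            (AE \<omega> in M. \<forall>a. \<forall>\<epsilon>0>0.
               (\<lambda>n. SUP \<epsilon>\<in>cball 0 \<epsilon>0. \<bar>\<Lambda> (int n) a \<epsilon> \<omega> - L a \<epsilon> \<omega>\<bar>) \<in> o(\<lambda>n. r \<epsilon>0 ^ n) \<and>
               (\<lambda>n. SUP \<epsilon>\<in>cball 0 \<epsilon>0. \<bar>\<Lambda> (- int n) a \<epsilon> \<omega> - Lbar a \<epsilon> \<omega>\<bar>) \<in> o(\<lambda>n. r \<epsilon>0 ^ n)))"
proof -
  interpret prob_space M by fact
  obtain \<kappa> :: nat and \<delta> :: real where \<kappa>: "\<kappa> \<ge> 1" and \<delta>: "0 < \<delta>"
    and mix_\<eta>: "\<And>a b s t. \<bar>s - t\<bar> \<ge> int \<kappa> \<Longrightarrow> \<P>(\<omega> in M. \<eta> t \<omega> = b \<bar> \<eta> s \<omega> = a) \<ge> \<delta>"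
    using A2(2) by blast
  have \<eta>_meas: "\<eta> t \<in> measurable M (count_space UNIV)" for t
    using A2(1) by (simp add: markov_chain_def)
  have chain: "markov_chain M \<sigma>"
    by (rule markov_chain_of_distr_eq[OF sigma_copy(2,1) A2(1)])
  have mix: "\<delta> \<le> \<P>(\<omega> in M. \<sigma> t \<omega> = b \<bar> \<sigma> s \<omega> = a)" if "\<bar>s - t\<bar> \<ge> int \<kappa>" for a b s t
    using mix_\<eta>[OF that] by (simp only: cond_prob_eq_of_distr_eq[OF sigma_copy(2,1) \<eta>_meas])
  \<comment> \<open>A null event would make the conditional probability \<open>0 / 0 = 0\<close>, against mixing.\<close>
  have pos: "0 < prob {\<omega> \<in> space M. \<sigma> t \<omega> = a}" for t a
  proof (rule ccontr)
    assume "\<not> ?thesis"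
    then have "prob {\<omega> \<in> space M. \<sigma> t \<omega> = a} = 0" by (simp add: zero_less_measure_iff)
    then show False using mix[of t "t + int \<kappa>" a a] \<delta> by (simp add: cond_prob_def)
  qed
  define g where "g z a b \<epsilon> = enn2real (f (\<phi> z (\<theta> a \<epsilon>)) (\<theta> b \<epsilon>))" for z a b \<epsilon>
  have g_pos: "0 < g z a b \<epsilon>" for z a b \<epsilon>
    using A3(1)[of z a \<epsilon> b] by (simp add: g_def enn2real_positive_iff)
  have g_cont: "continuous_on UNIV (g z a b)" for z a b
    unfolding continuous_on_def
  proof
    fix \<epsilon>
    have "((\<lambda>\<epsilon>. f (\<phi> z (\<theta> a \<epsilon>)) (\<theta> b \<epsilon>)) \<longlongrightarrow> f (\<phi> z (\<theta> a \<epsilon>)) (\<theta> b \<epsilon>)) (at \<epsilon>)"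
      using A3(2)[of z a b] by (simp add: continuous_on_def)
    then show "(g z a b \<longlongrightarrow> g z a b \<epsilon>) (at \<epsilon> within UNIV)"
      unfolding g_def[abs_def] using A3(1)[of z a \<epsilon> b] by (intro tendsto_enn2real) simp_all
  qed
  have g_meas: "(\<lambda>z. g z a b \<epsilon>) \<in> borel_measurable borel" for a b \<epsilon>
  proof -
    have "(\<lambda>x. f x (\<theta> b \<epsilon>)) \<in> borel_measurable lborel"
      using A1(4)[of "\<theta> b \<epsilon>" 0] \<open>\<And>a \<epsilon>. \<theta> a \<epsilon> \<in> \<Theta>\<close> by (simp add: distributed_def)
    moreover have "(\<lambda>z. \<phi> z (\<theta> a \<epsilon>)) \<in> borel_measurable borel"
      using assms by blast
    ultimately show ?thesis unfolding g_def by measurable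
  qed

  interpret fwd: positive_markov M "\<lambda>s. \<sigma> (int s)"
    by (rule positive_markov_forward[OF \<open>prob_space M\<close> chain pos])
  interpret bwd: positive_markov M "\<lambda>s. \<sigma> (- int s)"
    by (rule positive_markov_backward[OF \<open>prob_space M\<close> chain pos])
  have fwd_eq: "fwd.weighted_cond_exp (\<lambda>\<omega> s c. g (Z (int s) \<omega>) (\<eta> (int s) \<omega>) c \<epsilon>) n a \<omega> =
      cond_expect_sigma M f \<phi> \<theta> Z \<eta> \<sigma> (int n) a \<epsilon> \<omega>" for n a \<epsilon> \<omega>
    unfolding fwd.weighted_cond_exp_def cond_expect_sigma_def psi_def g_def
    by (intro Bochner_Integration.integral_cong prod.cong) auto
  have bwd_eq: "bwd.weighted_cond_exp (\<lambda>\<omega> s c. g (Z (- int s) \<omega>) (\<eta> (- int s) \<omega>) c \<epsilon>) n a \<omega> =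
      cond_expect_sigma M f \<phi> \<theta> Z \<eta> \<sigma> (- int n) a \<epsilon> \<omega>" for n a \<epsilon> \<omega>
    unfolding bwd.weighted_cond_exp_def cond_expect_sigma_def psi_def g_def
    by (intro Bochner_Integration.integral_cong prod.cong) auto
  have ratio: "cond_expect_sigma M f \<phi> \<theta> Z \<eta> \<sigma> k a \<epsilon> \<omega> / cond_expect_sigma M f \<phi> \<theta> Z \<eta> \<sigma> k i \<epsilon> \<omega> =
      \<Lambda> k a \<epsilon> \<omega>" for k a \<epsilon> \<omega>
    by (simp add: \<Lambda>_def Lambda_def)

  have mix_fwd: "\<delta> \<le> \<P>(\<omega> in M. \<sigma> (int (m + \<kappa>)) \<omega> = b \<bar> \<sigma> (int m) \<omega> = a)" for m a b
    by (rule mix) simp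
  have mix_bwd: "\<delta> \<le> \<P>(\<omega> in M. \<sigma> (- int (m + \<kappa>)) \<omega> = b \<bar> \<sigma> (- int m) \<omega> = a)" for m a b
    by (rule mix) simp
  have "0 < \<kappa>" using \<kappa> by simp
  have ind_fwd: "indep_vars (\<lambda>_. borel) (\<lambda>s. Z (int s)) UNIV"
    by (rule indep_vars_reindex_inj[OF A1(2)]) (simp add: inj_def)
  have ind_bwd: "indep_vars (\<lambda>_. borel) (\<lambda>s. Z (- int s)) UNIV"
    by (rule indep_vars_reindex_inj[OF A1(2)]) (simp add: inj_def)
  obtain S1 :: "nat \<Rightarrow> real" where S1: "\<And>k. 0 < S1 k" "\<And>k. S1 k < 1"
    and lim1: "AE \<omega> in M. \<forall>a.
       (\<forall>K. compact K \<longrightarrow> uniform_limit K (\<lambda>n \<epsilon>. \<Lambda> (int n) a \<epsilon> \<omega>) (\<lambda>\<epsilon>. L a \<epsilon> \<omega>) sequentially) \<and>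
       (\<forall>\<epsilon>. L a \<epsilon> \<omega> > 0) \<and> continuous_on UNIV (\<lambda>\<epsilon>. L a \<epsilon> \<omega>) \<and>
       (\<forall>k \<epsilon>0 r. 0 < \<epsilon>0 \<longrightarrow> \<epsilon>0 \<le> real k \<longrightarrow> S1 k \<le> r \<longrightarrow> r < 1 \<longrightarrow>
          (\<lambda>n. SUP \<epsilon>\<in>cball 0 \<epsilon>0. \<bar>\<Lambda> (int n) a \<epsilon> \<omega> - L a \<epsilon> \<omega>\<bar>) \<in> o(\<lambda>n. r ^ n))"
    using fwd.likelihood_ratio_limit[where g = g and \<zeta> = "\<lambda>s. Z (int s)" and E = "\<lambda>s. \<eta> (int s)" and i = i,
        OF \<delta> mix_fwd \<open>0 < \<kappa>\<close> ind_fwd A1(3) g_pos g_cont g_meas, unfolded fwd_eq ratio]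
    unfolding L_def by blast
  obtain S2 :: "nat \<Rightarrow> real" where S2: "\<And>k. 0 < S2 k" "\<And>k. S2 k < 1"
    and lim2: "AE \<omega> in M. \<forall>a.
       (\<forall>K. compact K \<longrightarrow> uniform_limit K (\<lambda>n \<epsilon>. \<Lambda> (- int n) a \<epsilon> \<omega>) (\<lambda>\<epsilon>. Lbar a \<epsilon> \<omega>) sequentially) \<and>
       (\<forall>\<epsilon>. Lbar a \<epsilon> \<omega> > 0) \<and> continuous_on UNIV (\<lambda>\<epsilon>. Lbar a \<epsilon> \<omega>) \<and>
       (\<forall>k \<epsilon>0 r. 0 < \<epsilon>0 \<longrightarrow> \<epsilon>0 \<le> real k \<longrightarrow> S2 k \<le> r \<longrightarrow> r < 1 \<longrightarrow>
          (\<lambda>n. SUP \<epsilon>\<in>cball 0 \<epsilon>0. \<bar>\<Lambda> (- int n) a \<epsilon> \<omega> - Lbar a \<epsilon> \<omega>\<bar>) \<in> o(\<lambda>n. r ^ n))"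
    using bwd.likelihood_ratio_limit[where g = g and \<zeta> = "\<lambda>s. Z (- int s)" and E = "\<lambda>s. \<eta> (- int s)" and i = i,
        OF \<delta> mix_bwd \<open>0 < \<kappa>\<close> ind_bwd A1(3) g_pos g_cont g_meas, unfolded bwd_eq ratio]
    unfolding Lbar_def by blast

  \<comment> \<open>The rate for radius \<open>x\<close> must dominate the rates of both time directions for the integer radius above \<open>x\<close>.\<close>
  obtain r :: "real \<Rightarrow> real" where r_mono: "strict_mono_on {0<..} r"
    and r01: "\<And>x. 0 < x \<Longrightarrow> 0 < r x \<and> r x < 1"
    and r_ge: "\<And>x. 0 < x \<Longrightarrow> max (S1 (nat \<lceil>x\<rceil>)) (S2 (nat \<lceil>x\<rceil>)) \<le> r x"
    by (rule strict_mono_rate_above[of "\<lambda>k. max (S1 k) (S2 k)"]) (simp_all add: S1 S2 less_max_iff_disj)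
  have rates: "AE \<omega> in M. \<forall>a. \<forall>\<epsilon>0>0.
       (\<lambda>n. SUP \<epsilon>\<in>cball 0 \<epsilon>0. \<bar>\<Lambda> (int n) a \<epsilon> \<omega> - L a \<epsilon> \<omega>\<bar>) \<in> o(\<lambda>n. r \<epsilon>0 ^ n) \<and>
       (\<lambda>n. SUP \<epsilon>\<in>cball 0 \<epsilon>0. \<bar>\<Lambda> (- int n) a \<epsilon> \<omega> - Lbar a \<epsilon> \<omega>\<bar>) \<in> o(\<lambda>n. r \<epsilon>0 ^ n)"
    using lim1 lim2
  proof eventually_elim
    case (elim \<omega>)
    show ?case
    proof (intro allI impI)
      fix a and \<epsilon>0 :: real assume e: "\<epsilon>0 > 0"
      have k: "\<epsilon>0 \<le> real (nat \<lceil>\<epsilon>0\<rceil>)" by (rule real_nat_ceiling_ge)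
      have "S1 (nat \<lceil>\<epsilon>0\<rceil>) \<le> r \<epsilon>0" "S2 (nat \<lceil>\<epsilon>0\<rceil>) \<le> r \<epsilon>0" "r \<epsilon>0 < 1" using r_ge[OF e] r01[OF e] by auto
      then show "(\<lambda>n. SUP \<epsilon>\<in>cball 0 \<epsilon>0. \<bar>\<Lambda> (int n) a \<epsilon> \<omega> - L a \<epsilon> \<omega>\<bar>) \<in> o(\<lambda>n. r \<epsilon>0 ^ n) \<and>
       (\<lambda>n. SUP \<epsilon>\<in>cball 0 \<epsilon>0. \<bar>\<Lambda> (- int n) a \<epsilon> \<omega> - Lbar a \<epsilon> \<omega>\<bar>) \<in> o(\<lambda>n. r \<epsilon>0 ^ n)"
        using elim e k by blast
    qed
  qed
  have limits: "AE \<omega> in M. \<forall>a.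
            (\<forall>K. compact K \<longrightarrow>
               uniform_limit K (\<lambda>n \<epsilon>. \<Lambda> (int n) a \<epsilon> \<omega>) (\<lambda>\<epsilon>. L a \<epsilon> \<omega>) sequentially \<and>
               uniform_limit K (\<lambda>n \<epsilon>. \<Lambda> (- int n) a \<epsilon> \<omega>) (\<lambda>\<epsilon>. Lbar a \<epsilon> \<omega>) sequentially) \<and>
            (\<forall>\<epsilon>. L a \<epsilon> \<omega> > 0) \<and> continuous_on UNIV (\<lambda>\<epsilon>. L a \<epsilon> \<omega>) \<and>
            (\<forall>\<epsilon>. Lbar a \<epsilon> \<omega> > 0) \<and> continuous_on UNIV (\<lambda>\<epsilon>. Lbar a \<epsilon> \<omega>)"
    using lim1 lim2
  proof eventually_elim
    case (elim \<omega>)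
    show ?case by (intro allI) (use elim in simp)
  qed
  have "\<forall>\<epsilon>0>0. 0 < r \<epsilon>0 \<and> r \<epsilon>0 < 1" using r01 by simp
  then show ?thesis
    using limits r_mono rates by (intro conjI exI[of _ r])
qed

end
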